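(* Let $n$ and $d$ be integers with $2 \le d \le n-1$ and $n+d \equiv 1 \pmod 2$. Then $$\overline{\mathrm{CR}}(R_{n,d}) = \frac{1}{24}\,nd\,(3nd-2d^2-6d+2).$$
   Context: A rectilinear drawing of a graph $G$ places the vertices at distinct points of the plane and draws each edge as the straight line segment joining its endpoints. A crossing is an intersection point of exactly two edges that is not a vertex. The maximum rectilinear crossing number $\overline{\mathrm{CR}}(G)$ of a graph $G$ is the maximum number of crossings over all rectilinear drawings of $G$. $R_{n,d}$ denotes the class of all $d$-regular graphs on $n$ vertices, and $\overline{\mathrm{CR}}(R_{n,d})$ denotes the maximum of $\overline{\mathrm{CR}}(G)$ over all $G \in R_{n,d}$. *)

theory Defs
  imports "HOL-Analysis.Analysis"
begin

text \<open>A finite simple graph is given by its vertex set \<open>V\<close> and its edge set \<open>E\<close>,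
  the edges being two-element subsets of \<open>V\<close>.\<close>

definition simple_graph :: "'a set \<Rightarrow> 'a set set \<Rightarrow> bool" where
  "simple_graph V E \<longleftrightarrow> finite V \<and> (\<forall>e\<in>E. e \<subseteq> V \<and> card e = 2)"

definition degree :: "'a set set \<Rightarrow> 'a \<Rightarrow> nat" where
  "degree E v = card {e \<in> E. v \<in> e}"

text \<open>Vertices are natural numbers without loss of generality: every finite graph is
  isomorphic to one of these.  Graphs need not be connected.\<close>

definition regular_graphs :: "nat \<Rightarrow> nat \<Rightarrow> (nat set \<times> nat set set) set" where
  "regular_graphs n d =
     {(V, E). simple_graph V E \<and> card V = n \<and> (\<forall>v\<in>V. degree E v = d)}"

text \<open>No general position is required of a drawing: collinear vertices, edges passing
  through vertices and overlapping edges are all allowed.\<close>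

definition rectilinear_drawing :: "'a set \<Rightarrow> ('a \<Rightarrow> real^2) \<Rightarrow> bool" where
  "rectilinear_drawing V p \<longleftrightarrow> inj_on p V"

definition drawn_edge :: "('a \<Rightarrow> real^2) \<Rightarrow> 'a set \<Rightarrow> (real^2) set" where
  "drawn_edge p e = convex hull (p ` e)"

lemma drawn_edge_closed_segment: "drawn_edge p {u, v} = closed_segment (p u) (p v)"
  by (simp add: drawn_edge_def segment_convex_hull)

text \<open>A crossing is a point, not a vertex, that lies on exactly two edges and is the
  intersection point of these.  Requiring the intersection to be a single point
  matters only for collinear edges that overlap in a segment: the points of the overlap
  (infinitely many) do not count.  A point on three or more edges does not count either.\<close>

definition crossings :: "'a set \<Rightarrow> 'a set set \<Rightarrow> ('a \<Rightarrow> real^2) \<Rightarrow> (real^2) set" where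
  "crossings V E p =
     {x. x \<notin> p ` V \<and>
         (\<exists>e f. e \<noteq> f \<and> {g \<in> E. x \<in> drawn_edge p g} = {e, f} \<and>
                drawn_edge p e \<inter> drawn_edge p f = {x})}"

definition max_rect_cr :: "'a set \<Rightarrow> 'a set set \<Rightarrow> nat" where
  "max_rect_cr V E = Max {card (crossings V E p) |p. rectilinear_drawing V p}"

definition max_rect_cr_regular :: "nat \<Rightarrow> nat \<Rightarrow> nat" where
  "max_rect_cr_regular n d = Max {max_rect_cr V E |V E. (V, E) \<in> regular_graphs n d}"

text \<open>The maxima range over finite sets, and the first one over a nonempty set, so
  \<^const>\<open>Max\<close> has its intended meaning; that \<^term>\<open>regular_graphs n d\<close> is nonempty
  depends on \<open>n\<close> and \<open>d\<close>.\<close>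

lemma simple_graph_finite_edges:
  assumes "simple_graph V E"
  shows "finite E" "card E \<le> 2 ^ card V"
proof -
  have sub: "E \<subseteq> Pow V" and fin: "finite V"
    using assms by (auto simp: simple_graph_def)
  show "finite E" using sub fin by (meson finite_Pow_iff finite_subset)
  show "card E \<le> 2 ^ card V"
    using card_mono[OF _ sub] fin by (simp add: card_Pow)
qed

lemma crossings_bound:
  assumes "finite E"
  shows "finite (crossings V E p)" "card (crossings V E p) \<le> card E * card E"
proof -
  let ?h = "\<lambda>(e, f). THE x. drawn_edge p e \<inter> drawn_edge p f = {x}"
  have sub: "crossings V E p \<subseteq> ?h ` (E \<times> E)"
  proof
    fix x assume "x \<in> crossings V E p"
    then obtain e f where ef: "{g \<in> E. x \<in> drawn_edge p g} = {e, f}"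
      and int: "drawn_edge p e \<inter> drawn_edge p f = {x}"
      unfolding crossings_def mem_Collect_eq by blast
    have "(e, f) \<in> E \<times> E" using ef by blast
    moreover have "?h (e, f) = x" by (simp add: int)
    ultimately show "x \<in> ?h ` (E \<times> E)" by (rule rev_image_eqI[OF _ sym])
  qed
  have fin: "finite (E \<times> E)" using assms by simp
  show "finite (crossings V E p)" using finite_subset[OF sub] fin by blast
  have "card (crossings V E p) \<le> card (?h ` (E \<times> E))"
    using card_mono[OF _ sub] fin by blast
  also have "\<dots> \<le> card (E \<times> E)" by (rule card_image_le[OF fin])
  finally show "card (crossings V E p) \<le> card E * card E"
    by (simp add: card_cartesian_product)
qed

lemma max_rect_cr_set_finite:
  assumes "simple_graph V E"
  shows "finite {card (crossings V E p) |p. rectilinear_drawing V p}"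
  by (rule finite_subset[of _ "{..card E * card E}"])
     (use crossings_bound(2)[OF simple_graph_finite_edges(1)[OF assms]] in auto)

lemma max_rect_cr_set_nonempty:
  assumes "simple_graph V E"
  shows "{card (crossings V E p) |p. rectilinear_drawing V p} \<noteq> {}"
proof -
  obtain f :: "'a \<Rightarrow> nat" where f: "inj_on f V"
    using finite_imp_inj_to_nat_seg[of V] assms unfolding simple_graph_def by blast
  have "inj_on (\<lambda>v. of_nat (f v) :: real^2) V"
    using f by (simp only: inj_on_def of_nat_eq_iff)
  then have "rectilinear_drawing V (\<lambda>v. of_nat (f v) :: real^2)"
    by (simp only: rectilinear_drawing_def)
  then show ?thesis by blast
qed

lemma max_rect_cr_regular_set_finite:
  "finite {max_rect_cr V E |V E. (V, E) \<in> regular_graphs n d}"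
proof (rule finite_subset[of _ "{..(2 ^ n) * (2 ^ n)}"])
  show "{max_rect_cr V E |V E. (V, E) \<in> regular_graphs n d} \<subseteq> {..(2 ^ n) * (2 ^ n)}"
  proof (intro subsetI, elim CollectE exE conjE, simp only: atMost_iff)
    fix V E assume VE: "(V, E) \<in> regular_graphs n d"
    then have G: "simple_graph V E" and n: "card V = n"
      by (auto simp: regular_graphs_def)
    have "max_rect_cr V E \<in> {card (crossings V E p) |p. rectilinear_drawing V p}"
      unfolding max_rect_cr_def
      by (rule Max_in[OF max_rect_cr_set_finite[OF G] max_rect_cr_set_nonempty[OF G]])
    then have "max_rect_cr V E \<le> card E * card E"
      using crossings_bound(2)[OF simple_graph_finite_edges(1)[OF G]] by auto
    also have "\<dots> \<le> 2 ^ n * 2 ^ n"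
      using simple_graph_finite_edges(2)[OF G] n by (intro mult_mono) auto
    finally show "max_rect_cr V E \<le> 2 ^ n * 2 ^ n" .
  qed
qed simp

end

theory Submission
  imports Defs
begin

text \<open>Let \<open>D = d - 1\<close>.  A \<open>d\<close>-regular graph has \<open>nd(nd - 4d + 2)/8\<close> pairs of disjoint edges,
  so the claim is that at least \<open>nd(d - 1)(d - 2)/12\<close> of them fail to cross, and that this can be
  attained.  Perturb the drawing to general position without losing crossings.  Count paths
  \<open>b, a, c, e\<close> whose end edges lie on opposite sides of the line \<open>ac\<close>: the end edges then do not
  cross, and every non-crossing pair arises from at most two such unoriented paths.  If \<open>L, R\<close>
  (respectively \<open>L', R'\<close>) other edges at \<open>a\<close> (at \<open>c\<close>) lie to the left and to the right of the edge
  seen from that end, then \<open>L + R = L' + R' = D\<close> and there are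
  \<open>L L' + R R' = L R + L' R' + (L - R')\<^sup>2\<close> such paths.  Finally the sum of \<open>L R\<close> over the edges at a vertex
  is at least \<open>d choose 3\<close>, because among three rays one separates the other two.

  Equality holds throughout when the points are in convex position and each is joined to the \<open>d\<close>
  cyclically most distant ones: reflections give \<open>L = R'\<close>.\<close>

lemma card_filter_sum: "finite A \<Longrightarrow> card {x \<in> A. Q x} = (\<Sum>x\<in>A. of_bool (Q x))"
  by (simp add: Collect_conj_eq)

section \<open>Crossing pairs of edges from abstract orientations\<close>

text \<open>The axioms on \<open>ccw\<close> are part of those of Knuth's CC systems.  Points in
  general position satisfy them, and nothing else about the drawing enters the count.\<close>

locale ccw_regular_graph =
  fixes V :: "'a set" and adj :: "'a \<Rightarrow> 'a \<Rightarrow> bool"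
    and ccw :: "'a \<Rightarrow> 'a \<Rightarrow> 'a \<Rightarrow> bool" and d :: nat
  assumes finite_V: "finite V"
    and adj_V: "adj a b \<Longrightarrow> a \<in> V"
    and adj_sym: "adj a b \<Longrightarrow> adj b a"
    and adj_irrefl: "\<not> adj a a"
    and regular: "v \<in> V \<Longrightarrow> card {w. adj v w} = d"
    and ccw_rotate: "ccw a b c \<Longrightarrow> ccw b c a"
    and ccw_swap: "\<lbrakk>a \<in> V; b \<in> V; c \<in> V; distinct [a, b, c]\<rbrakk> \<Longrightarrow> ccw b a c \<longleftrightarrow> \<not> ccw a b c"
    and ccw_interior: "\<lbrakk>ccw a b t; ccw b c t; ccw c a t\<rbrakk> \<Longrightarrow> ccw a b c"
begin

abbreviation nbrs :: "'a \<Rightarrow> 'a set" where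
  "nbrs v \<equiv> {w. adj v w}"

definition darts :: "('a \<times> 'a) set" where
  "darts = (SIGMA v:V. nbrs v)"

text \<open>An unordered pair of disjoint edges occurs as eight quadruples, by the order of the two
  edges and the direction of each. Counts below therefore carry a factor 8.\<close>

definition disjoint_pairs :: "('a \<times> 'a \<times> 'a \<times> 'a) set" where
  "disjoint_pairs = {(a, b, c, e). adj a b \<and> adj c e \<and> distinct [a, b, c, e]}"

definition cross :: "'a \<Rightarrow> 'a \<Rightarrow> 'a \<Rightarrow> 'a \<Rightarrow> bool" where
  "cross a b c e \<longleftrightarrow> ccw a b c \<noteq> ccw a b e \<and> ccw c e a \<noteq> ccw c e b"

definition separated :: "'a \<Rightarrow> 'a \<Rightarrow> 'a \<Rightarrow> 'a \<Rightarrow> bool" where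
  "separated a c b e \<longleftrightarrow> ccw a c b \<noteq> ccw a c e"

definition left :: "'a \<Rightarrow> 'a \<Rightarrow> 'a set" where
  "left a c = {b \<in> nbrs a - {c}. ccw a c b}"

text \<open>By \<open>ccw_swap\<close> three distinct vertices are never collinear, so the negation
  of \<open>ccw\<close> really means the other side.\<close>

definition right :: "'a \<Rightarrow> 'a \<Rightarrow> 'a set" where
  "right a c = {b \<in> nbrs a - {c}. \<not> ccw a c b}"

lemma nbrs_subset: "nbrs v \<subseteq> V"
  using adj_V adj_sym by blast

lemma finite_nbrs [simp]: "finite (nbrs v)"
  using finite_subset[OF nbrs_subset finite_V] .

lemma finite_darts [simp]: "finite darts"
  unfolding darts_def using finite_V by (intro finite_SigmaI) auto

lemma mem_darts: "(a, b) \<in> darts \<longleftrightarrow> adj a b"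
  unfolding darts_def using adj_V by auto

lemma card_darts: "card darts = card V * d"
  unfolding darts_def using finite_V regular by simp

lemma finite_disjoint_pairs [simp]: "finite disjoint_pairs"
proof (rule finite_subset)
  show "disjoint_pairs \<subseteq> V \<times> V \<times> V \<times> V"
    unfolding disjoint_pairs_def using adj_V adj_sym by blast
qed (use finite_V in auto)

lemma finite_left [simp]: "finite (left a c)"
  by (rule finite_subset[OF _ finite_nbrs[of a]]) (auto simp: left_def)

lemma finite_right [simp]: "finite (right a c)"
  by (rule finite_subset[OF _ finite_nbrs[of a]]) (auto simp: right_def)

lemma card_left_right:
  assumes "adj a c"
  shows "card (left a c) + card (right a c) = d - 1"
proof -
  have "card (left a c) + card (right a c) = card (left a c \<union> right a c)"
    by (rule card_Un_disjoint[symmetric]) (auto simp: left_def right_def)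
  also have "left a c \<union> right a c = nbrs a - {c}"
    by (auto simp: left_def right_def)
  also have "card \<dots> = d - 1"
    using assms regular adj_V by simp
  finally show ?thesis .
qed

lemma degree_pos: "adj a c \<Longrightarrow> 0 < d"
  by (metis adj_V card_gt_0_iff empty_iff finite_nbrs mem_Collect_eq regular)

section \<open>Counting ordered pairs of disjoint edges\<close>

lemma card_darts_at:
  assumes "v \<in> V"
  shows "card {(x, y). adj x y \<and> x = v} = d" "card {(x, y). adj x y \<and> y = v} = d"
proof -
  have "{(x, y). adj x y \<and> x = v} = Pair v ` nbrs v" by auto
  then show "card {(x, y). adj x y \<and> x = v} = d"
    using regular[OF assms] by (simp add: card_image inj_on_def)
  have "{(x, y). adj x y \<and> y = v} = (\<lambda>w. (w, v)) ` nbrs v" using adj_sym by auto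
  then show "card {(x, y). adj x y \<and> y = v} = d"
    using regular[OF assms] by (simp add: card_image inj_on_def)
qed

text \<open>Inclusion-exclusion: \<open>2 * d\<close> darts start in \<open>{a, b}\<close> and
  \<open>2 * d\<close> end there, while the two darts of the edge \<open>a b\<close> do both, hence
  the final \<open>+ 2\<close>.\<close>

lemma card_darts_avoiding:
  assumes "adj a b"
  shows "int (card {(c, e). adj c e \<and> distinct [a, b, c, e]}) = int (card V * d) - 4 * int d + 2"
proof -
  let ?X = "{(c, e). adj c e \<and> distinct [a, b, c, e]}"
  let ?A = "\<lambda>v. {(x, y). adj x y \<and> x = v}" and ?B = "\<lambda>v. {(x, y). adj x y \<and> y = v}"
  have V: "a \<in> V" "b \<in> V" and ab: "a \<noteq> b" "adj b a"
    using assms adj_V adj_sym adj_irrefl by blast+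
  have sub: "?A v \<subseteq> darts" "?B v \<subseteq> darts" for v by (auto simp: mem_darts)
  have fin [simp]: "finite (?A v)" "finite (?B v)" for v
    using sub finite_subset[OF _ finite_darts] by blast+
  have split: "darts = ?X \<union> ((?A a \<union> ?A b) \<union> (?B a \<union> ?B b))" (is "_ = _ \<union> ?U")
    using ab adj_irrefl by (auto simp: mem_darts)
  have "finite ?X" by (rule finite_subset[OF _ finite_darts]) (auto simp: mem_darts)
  then have 1: "card darts = card ?X + card ?U"
    by (subst split, intro card_Un_disjoint) auto
  have 2: "card (?A a \<union> ?A b) = 2 * d"
    using card_darts_at V ab by (subst card_Un_disjoint) auto
  have 3: "card (?B a \<union> ?B b) = 2 * d"
    using card_darts_at V ab by (subst card_Un_disjoint) auto
  have "(?A a \<union> ?A b) \<inter> (?B a \<union> ?B b) = {(a, b), (b, a)}"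
    using ab assms adj_irrefl by auto
  then have 4: "card ((?A a \<union> ?A b) \<inter> (?B a \<union> ?B b)) = 2"
    using ab by simp
  have "card ?U + 2 = 4 * d"
    using card_Un_Int[of "?A a \<union> ?A b" "?B a \<union> ?B b"] 2 3 4 by simp
  then show ?thesis using 1 card_darts by linarith
qed

lemma card_disjoint_pairs:
  "int (card disjoint_pairs) = int (card V * d) * (int (card V * d) - 4 * int d + 2)"
proof -
  let ?X = "\<lambda>(a, b). {(c, e). adj c e \<and> distinct [a, b, c, e]}"
  let ?f = "\<lambda>((a, b), c, e). (a, b, c, e)"
  have fin: "finite (?X z)" for z
    by (rule finite_subset[OF _ finite_darts]) (auto simp: mem_darts split: prod.splits)
  have "disjoint_pairs = ?f ` (SIGMA z:darts. ?X z)"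
    by (force simp: disjoint_pairs_def mem_darts image_iff)
  moreover have "inj_on ?f (SIGMA z:darts. ?X z)" by (auto simp: inj_on_def)
  ultimately have "card disjoint_pairs = (\<Sum>z\<in>darts. card (?X z))"
    using fin by (simp add: card_image)
  also have "int \<dots> = (\<Sum>z\<in>darts. int (card V * d) - 4 * int d + 2)"
    unfolding of_nat_sum using card_darts_avoiding by (intro sum.cong) (auto simp: mem_darts)
  finally show ?thesis using card_darts by simp
qed

section \<open>Non-crossing pairs and separating connecting lines\<close>

lemma sum_disjoint_pairs_swap:
  "(\<Sum>(a, b, c, e)\<in>disjoint_pairs. f b a c e) = (\<Sum>(a, b, c, e)\<in>disjoint_pairs. f a b c e)"
  "(\<Sum>(a, b, c, e)\<in>disjoint_pairs. f a b e c) = (\<Sum>(a, b, c, e)\<in>disjoint_pairs. f a b c e)"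
  by (rule sum.reindex_bij_witness[where i = "\<lambda>(a, b, c, e). (b, a, c, e)" and j = "\<lambda>(a, b, c, e). (b, a, c, e)"]
     sum.reindex_bij_witness[where i = "\<lambda>(a, b, c, e). (a, b, e, c)" and j = "\<lambda>(a, b, c, e). (a, b, e, c)"];
     use adj_sym in \<open>auto simp: disjoint_pairs_def\<close>)+

text \<open>Two disjoint edges \<open>ab\<close> and \<open>ce\<close> have four possible connecting edges.  If they do not
  cross, exactly two of these separate the remaining two ends; if they cross, none does.\<close>

lemma separations_of_pair:
  assumes "(a, b, c, e) \<in> disjoint_pairs"
  shows "of_bool (separated a c b e) + of_bool (separated b c a e) +
    of_bool (separated a e b c) + of_bool (separated b e a c) = (2 * of_bool (\<not> cross a b c e) :: nat)"
proof -
  have V: "a \<in> V" "b \<in> V" "c \<in> V" "e \<in> V" and dist: "distinct [a, b, c, e]"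
    using assms adj_V adj_sym by (auto simp: disjoint_pairs_def)
  have rot: "ccw x y z = ccw y z x" for x y z using ccw_rotate by blast
  have swaps: "ccw a c b = (\<not> ccw a b c)" "ccw a e b = (\<not> ccw a b e)" "ccw a e c = (\<not> ccw a c e)"
    "ccw b e c = (\<not> ccw b c e)"
    using V dist rot ccw_swap[of a b c] ccw_swap[of a b e] ccw_swap[of a c e] ccw_swap[of b c e]
    by auto
  have rots: "ccw b c a = ccw a b c" "ccw b e a = ccw a b e" "ccw c e a = ccw a c e" "ccw c e b = ccw b c e"
    using rot by blast+
  \<comment> \<open>The two excluded sign patterns put \<open>e\<close> to the left (in
    \<open>int2\<close>: to the right) of all three sides \<open>a b\<close>, \<open>b c\<close>,
    \<open>c a\<close>, although the triangle has the opposite orientation. The remaining patterns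
    are checked one by one.\<close>
  have int1: "\<not> (ccw b c e \<and> \<not> ccw a c e \<and> ccw a b e \<and> \<not> ccw a b c)"
    using ccw_interior[of a b e c] V dist ccw_swap[of a c e] by auto
  have int2: "\<not> (\<not> ccw b c e \<and> ccw a c e \<and> \<not> ccw a b e \<and> ccw a b c)"
    using ccw_interior[of a c e b] V dist ccw_swap[of b c e] ccw_swap[of a b e] swaps by auto
  show ?thesis
    unfolding separated_def cross_def swaps rots using int1 int2
    by (cases "ccw a b c"; cases "ccw a b e"; cases "ccw a c e"; cases "ccw b c e") auto
qed

text \<open>Reversing either edge permutes \<open>disjoint_pairs\<close>, so the four terms of
  \<open>separations_of_pair\<close> have the same sum. Four times this sum is twice the number of
  non-crossing pairs.\<close>

lemma noncrossing_eq_separated: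
  "card {(a, b, c, e) \<in> disjoint_pairs. \<not> cross a b c e} =
   2 * card {(a, b, c, e) \<in> disjoint_pairs. separated a c b e}"
proof -
  let ?S = "\<lambda>f. \<Sum>(a, b, c, e)\<in>disjoint_pairs. (f a b c e :: nat)"
  let ?z = "\<lambda>a b c e. of_bool (separated a c b e) :: nat"
  have card: "card {(a, b, c, e) \<in> disjoint_pairs. Q a b c e} = ?S (\<lambda>a b c e. of_bool (Q a b c e))" for Q
    using card_filter_sum[OF finite_disjoint_pairs, of "\<lambda>(a, b, c, e). Q a b c e"]
    by (simp add: case_prod_unfold)
  have "?S ?z + ?S (\<lambda>a b c e. ?z b a c e) + ?S (\<lambda>a b c e. ?z a b e c) + ?S (\<lambda>a b c e. ?z b a e c)
      = ?S (\<lambda>a b c e. ?z a b c e + ?z b a c e + ?z a b e c + ?z b a e c)"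
    by (simp add: case_prod_unfold sum.distrib)
  also have "\<dots> = ?S (\<lambda>a b c e. 2 * of_bool (\<not> cross a b c e))"
    using separations_of_pair by (intro sum.cong) auto
  also have "\<dots> = 2 * card {(a, b, c, e) \<in> disjoint_pairs. \<not> cross a b c e}"
    unfolding card by (simp add: case_prod_unfold sum_distrib_left)
  also have "?S (\<lambda>a b c e. ?z b a c e) = ?S ?z"
    by (rule sum_disjoint_pairs_swap(1))
  also have "?S (\<lambda>a b c e. ?z a b e c) = ?S ?z"
    by (rule sum_disjoint_pairs_swap(2))
  also have "?S (\<lambda>a b c e. ?z b a e c) = ?S ?z"
    using sum_disjoint_pairs_swap(1)[of "\<lambda>a b c e. ?z a b e c"] sum_disjoint_pairs_swap(2)[of ?z]
    by simp
  finally show ?thesis unfolding card by simp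
qed

text \<open>Left and right are exchanged when the line is seen from \<open>c\<close> instead of
  \<open>a\<close>. Ends on opposite sides are therefore both left or both right, each seen from its
  own end of the middle edge.\<close>

lemma card_separated_with_edge:
  "card {(a, b, c, e) \<in> disjoint_pairs. adj a c \<and> separated a c b e} =
   (\<Sum>(a, c)\<in>darts. card (left a c) * card (left c a) + card (right a c) * card (right c a))"
proof -
  let ?X = "\<lambda>(a, c). left a c \<times> left c a \<union> right a c \<times> right c a"
  let ?f = "\<lambda>((a, c), b, e). (a, b, c, e)"
  have swap: "ccw c a e = (\<not> ccw a c e)" if "adj a c" "adj c e" "e \<noteq> a" for a c e
    using that ccw_swap[of a c e] adj_V adj_sym adj_irrefl by (metis distinct_length_2_or_more distinct_singleton)
  have "{(a, b, c, e) \<in> disjoint_pairs. adj a c \<and> separated a c b e} = ?f ` (SIGMA z:darts. ?X z)"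
  proof (intro set_eqI iffI)
    fix z assume "z \<in> {(a, b, c, e) \<in> disjoint_pairs. adj a c \<and> separated a c b e}"
    then obtain a b c e where z: "z = (a, b, c, e)" and "adj a b" "adj c e" "distinct [a, b, c, e]"
      "adj a c" "ccw a c b \<noteq> ccw a c e"
      by (auto simp: disjoint_pairs_def separated_def)
    then have "((a, c), b, e) \<in> (SIGMA z:darts. ?X z)"
      using swap[of a c e] by (auto simp: mem_darts left_def right_def)
    then show "z \<in> ?f ` (SIGMA z:darts. ?X z)"
      using z by (intro image_eqI[where x = "((a, c), b, e)"]) auto
  next
    fix z assume "z \<in> ?f ` (SIGMA z:darts. ?X z)"
    then obtain a b c e where z: "z = (a, b, c, e)" and ac: "adj a c"
      and be: "(b, e) \<in> left a c \<times> left c a \<union> right a c \<times> right c a"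
      by (auto simp: mem_darts)
    then have *: "adj a b" "b \<noteq> c" "adj c e" "e \<noteq> a" "ccw a c b \<longleftrightarrow> ccw c a e"
      by (auto simp: left_def right_def)
    then have "ccw a c b \<noteq> ccw a c e" using swap ac by blast
    then show "z \<in> {(a, b, c, e) \<in> disjoint_pairs. adj a c \<and> separated a c b e}"
      using * ac z adj_irrefl by (auto simp: disjoint_pairs_def separated_def)
  qed
  moreover have "inj_on ?f (SIGMA z:darts. ?X z)" by (auto simp: inj_on_def)
  ultimately have "card {(a, b, c, e) \<in> disjoint_pairs. adj a c \<and> separated a c b e} = card (SIGMA z:darts. ?X z)"
    by (simp only: card_image)
  also have "\<dots> = (\<Sum>z\<in>darts. card (?X z))"
    by (rule card_SigmaI) auto
  also have "\<dots> = (\<Sum>(a, c)\<in>darts. card (left a c) * card (left c a) + card (right a c) * card (right c a))"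
  proof (intro sum.cong refl, clarify)
    fix a c
    have "left a c \<times> left c a \<inter> right a c \<times> right c a = {}"
      by (auto simp: left_def right_def)
    then show "card (left a c \<times> left c a \<union> right a c \<times> right c a) =
        card (left a c) * card (left c a) + card (right a c) * card (right c a)"
      by (simp add: card_Un_disjoint card_cartesian_product)
  qed
  finally show ?thesis .
qed

lemma sum_darts_swap: "(\<Sum>(a, c)\<in>darts. f c a) = (\<Sum>(a, c)\<in>darts. f a c)"
  by (rule sum.reindex_bij_witness[where i = prod.swap and j = prod.swap])
     (use adj_sym in \<open>auto simp: mem_darts\<close>)

text \<open>The sets \<open>left a c\<close> and \<open>right c a\<close> lie on the same side of
  the line \<open>a c\<close>. The difference vanishes if \<open>a\<close> and \<open>c\<close> have
  equally many further neighbours on that side.\<close>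

definition imbalance :: "'a \<Rightarrow> 'a \<Rightarrow> int" where
  "imbalance a c = int (card (left a c)) - int (card (right c a))"

text \<open>The products at the two ends of an edge have equal sums over all darts, by reversing
  darts. The squares are a loss that the upper bound discards and the extremal graph avoids.\<close>

lemma card_separated_with_edge_imbalance:
  "int (card {(a, b, c, e) \<in> disjoint_pairs. adj a c \<and> separated a c b e}) =
   2 * int (\<Sum>(a, c)\<in>darts. card (left a c) * card (right a c)) + (\<Sum>(a, c)\<in>darts. (imbalance a c)\<^sup>2)"
proof -
  let ?l = "\<lambda>a c. int (card (left a c))" and ?r = "\<lambda>a c. int (card (right a c))"
  have "?l a c * ?l c a + ?r a c * ?r c a = ?l a c * ?r a c + ?l c a * ?r c a + (imbalance a c)\<^sup>2"
    if "adj a c" for a c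
  proof -
    have "?l a c + ?r a c = ?l c a + ?r c a"
      using card_left_right[OF that] card_left_right[OF adj_sym[OF that]] by linarith
    then have "?l c a = ?l a c + ?r a c - ?r c a" by linarith
    then show ?thesis unfolding imbalance_def by algebra
  qed
  then have "(\<Sum>(a, c)\<in>darts. ?l a c * ?l c a + ?r a c * ?r c a) =
      (\<Sum>(a, c)\<in>darts. ?l a c * ?r a c + ?l c a * ?r c a + (imbalance a c)\<^sup>2)"
    by (intro sum.cong) (auto simp: mem_darts)
  also have "\<dots> = (\<Sum>(a, c)\<in>darts. ?l a c * ?r a c) + (\<Sum>(a, c)\<in>darts. ?l c a * ?r c a)
      + (\<Sum>(a, c)\<in>darts. (imbalance a c)\<^sup>2)"
    by (simp add: case_prod_unfold sum.distrib)
  also have "(\<Sum>(a, c)\<in>darts. ?l c a * ?r c a) = (\<Sum>(a, c)\<in>darts. ?l a c * ?r a c)"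
    by (rule sum_darts_swap)
  finally show ?thesis
    unfolding card_separated_with_edge by (simp add: case_prod_unfold)
qed

section \<open>Triples of rays at a vertex\<close>

definition nbr_triples :: "'a \<Rightarrow> ('a \<times> 'a \<times> 'a) set" where
  "nbr_triples v = {(x, y, z). {x, y, z} \<subseteq> nbrs v \<and> distinct [x, y, z]}"

lemma finite_nbr_triples [simp]: "finite (nbr_triples v)"
  by (rule finite_subset[of _ "nbrs v \<times> nbrs v \<times> nbrs v"]) (auto simp: nbr_triples_def)

lemma card_nbr_triples:
  assumes "v \<in> V"
  shows "card (nbr_triples v) = d * (d - 1) * (d - 2)"
proof -
  have "nbr_triples v = (SIGMA x:nbrs v. SIGMA y:nbrs v - {x}. nbrs v - {x, y})"
    by (auto simp: nbr_triples_def)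
  moreover have "card (SIGMA y:nbrs v - {x}. nbrs v - {x, y}) = (d - 1) * (d - 2)" if "x \<in> nbrs v" for x
  proof -
    have "card (nbrs v - {x, y}) = d - 2" if "y \<in> nbrs v - {x}" for y
      using that \<open>x \<in> nbrs v\<close> regular[OF assms] by (auto simp: card_Diff_subset)
    then show ?thesis using that regular[OF assms] by simp
  qed
  ultimately show ?thesis using regular[OF assms] by simp
qed

lemma sum_nbr_triples_rotate:
  "(\<Sum>(x, y, z)\<in>nbr_triples v. f y z x) = (\<Sum>(x, y, z)\<in>nbr_triples v. f x y z)"
  by (rule sum.reindex_bij_witness[where i = "\<lambda>(x, y, z). (z, x, y)" and j = "\<lambda>(x, y, z). (y, z, x)"])
     (auto simp: nbr_triples_def)

lemma separated_nbr_triples: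
  assumes "v \<in> V"
  shows "card {(x, y, z) \<in> nbr_triples v. separated v x y z} =
    2 * (\<Sum>x\<in>nbrs v. card (left v x) * card (right v x))"
proof -
  let ?X = "\<lambda>x. left v x \<times> right v x \<union> right v x \<times> left v x"
  have "{(x, y, z) \<in> nbr_triples v. separated v x y z} = (SIGMA x:nbrs v. ?X x)"
    by (auto simp: nbr_triples_def separated_def left_def right_def)
  then have "card {(x, y, z) \<in> nbr_triples v. separated v x y z} = (\<Sum>x\<in>nbrs v. card (?X x))"
    by simp
  also have "\<dots> = (\<Sum>x\<in>nbrs v. 2 * (card (left v x) * card (right v x)))"
  proof (intro sum.cong refl)
    fix x
    have "left v x \<times> right v x \<inter> right v x \<times> left v x = {}"
      by (auto simp: left_def right_def)
    then show "card (?X x) = 2 * (card (left v x) * card (right v x))"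
      by (simp add: card_Un_disjoint card_cartesian_product)
  qed
  finally show ?thesis by (simp add: sum_distrib_left)
qed

text \<open>Of three rays at \<open>v\<close> exactly one separates the other two, unless they
  surround \<open>v\<close>; then all three do. Rotating the triples gives a factor 3, and the two
  orders of the separated ends give a factor 2.\<close>

lemma star_count:
  assumes "v \<in> V"
  shows "6 * (\<Sum>x\<in>nbrs v. card (left v x) * card (right v x)) =
    d * (d - 1) * (d - 2) +
    2 * card {(x, y, z) \<in> nbr_triples v. ccw v x y = ccw v y z \<and> ccw v y z = ccw v z x}"
proof -
  let ?S = "\<lambda>f. \<Sum>(x, y, z)\<in>nbr_triples v. (f x y z :: nat)"
  let ?s = "\<lambda>x y z. of_bool (separated v x y z) :: nat"
  let ?c = "\<lambda>x y z. of_bool (ccw v x y = ccw v y z \<and> ccw v y z = ccw v z x) :: nat"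
  have card: "card {(x, y, z) \<in> nbr_triples v. Q x y z} = ?S (\<lambda>x y z. of_bool (Q x y z))" for Q
    using card_filter_sum[OF finite_nbr_triples, of v "\<lambda>(x, y, z). Q x y z"]
    by (simp add: case_prod_unfold)
  have sum3: "?s x y z + ?s y z x + ?s z x y = 1 + 2 * ?c x y z" if "(x, y, z) \<in> nbr_triples v" for x y z
  proof -
    have "{x, y, z} \<subseteq> V" "v \<notin> {x, y, z}" "distinct [x, y, z]"
      using that adj_irrefl nbrs_subset[of v] by (auto simp: nbr_triples_def)
    moreover have rot: "ccw x y z = ccw y z x" for x y z using ccw_rotate by blast
    ultimately have "ccw v x z = (\<not> ccw v z x)" "ccw v y x = (\<not> ccw v x y)" "ccw v z y = (\<not> ccw v y z)"
      using assms ccw_swap[of x v z] ccw_swap[of y v x] ccw_swap[of z v y] by auto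
    then show ?thesis
      unfolding separated_def
      by (cases "ccw v x y"; cases "ccw v y z"; cases "ccw v z x") auto
  qed
  have "3 * ?S ?s = ?S ?s + ?S (\<lambda>x y z. ?s y z x) + ?S (\<lambda>x y z. ?s z x y)"
    using sum_nbr_triples_rotate[of ?s v] sum_nbr_triples_rotate[of "\<lambda>x y z. ?s y z x" v] by simp
  also have "\<dots> = ?S (\<lambda>x y z. ?s x y z + ?s y z x + ?s z x y)"
    by (simp add: case_prod_unfold sum.distrib)
  also have "\<dots> = ?S (\<lambda>x y z. 1 + 2 * ?c x y z)"
    using sum3 by (intro sum.cong) auto
  also have "\<dots> = card (nbr_triples v) + 2 * ?S ?c"
    by (simp only: case_prod_unfold sum.distrib sum_distrib_left[symmetric]) simp
  finally show ?thesis
    using separated_nbr_triples[OF assms] card_nbr_triples[OF assms] unfolding card by simp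
qed

lemma sum_darts_star:
  "(\<Sum>(a, c)\<in>darts. f a c) = (\<Sum>a\<in>V. \<Sum>c\<in>nbrs a. f a c)"
  unfolding darts_def using finite_V by (simp add: sum.Sigma)

section \<open>The bound on crossing pairs and its equality case\<close>

lemma card_disjoint_pairs_split:
  "card disjoint_pairs = card {(a, b, c, e) \<in> disjoint_pairs. cross a b c e} +
    2 * card {(a, b, c, e) \<in> disjoint_pairs. separated a c b e}"
proof -
  have "disjoint_pairs = {(a, b, c, e) \<in> disjoint_pairs. cross a b c e} \<union>
      {(a, b, c, e) \<in> disjoint_pairs. \<not> cross a b c e}" (is "_ = ?A \<union> ?B") by auto
  moreover have "card (?A \<union> ?B) = card ?A + card ?B"
    by (intro card_Un_disjoint finite_subset[OF _ finite_disjoint_pairs]) auto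
  ultimately show ?thesis using noncrossing_eq_separated by simp
qed

lemma extremal_value_identity:
  assumes "0 < d" "int P = int (card V * d) * (int (card V * d) - 4 * int d + 2)"
  shows "3 * int P - 2 * int (card V * (d * (d - 1) * (d - 2))) =
    int (card V) * int d * (3 * int (card V) * int d - 2 * (int d)\<^sup>2 - 6 * int d + 2)"
proof -
  \<comment> \<open>For \<open>d = 1\<close> the difference \<open>d - 2\<close> is truncated on
    \<open>nat\<close>, but then the factor \<open>d - 1\<close> is zero.\<close>
  have "int d * int (d - 1) * int (d - 2) = int d * (int d - 1) * (int d - 2)"
    using assms(1) by (cases "d = 1") (auto simp: of_nat_diff)
  then show ?thesis
    unfolding assms(2) of_nat_mult by algebra
qed

text \<open>The chain is \<open>?W \<ge> ?T \<ge> 2 * ?M\<close>, where \<open>6 * ?M\<close> is at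
  least the number of neighbour triples by \<open>star_count\<close>. The factor is 3 and not 24
  because quadruples count each pair eight times.\<close>

lemma crossing_pairs_le:
  "3 * int (card {(a, b, c, e) \<in> disjoint_pairs. cross a b c e}) \<le>
    int (card V) * int d * (3 * int (card V) * int d - 2 * (int d)\<^sup>2 - 6 * int d + 2)"
proof (cases "d = 0")
  case True
  then have "disjoint_pairs = {}" using degree_pos by (auto simp: disjoint_pairs_def)
  then have "{(a, b, c, e) \<in> disjoint_pairs. cross a b c e} = {}" by auto
  then show ?thesis using True by (simp only: card.empty)
next
  case False
  let ?W = "card {(a, b, c, e) \<in> disjoint_pairs. separated a c b e}"
  let ?T = "card {(a, b, c, e) \<in> disjoint_pairs. adj a c \<and> separated a c b e}"
  let ?M = "\<Sum>(a, c)\<in>darts. card (left a c) * card (right a c)"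
  have "?T \<le> ?W"
    by (intro card_mono finite_subset[OF _ finite_disjoint_pairs]) auto
  moreover have "2 * int ?M \<le> int ?T"
    unfolding card_separated_with_edge_imbalance by (simp add: sum_nonneg case_prod_unfold)
  moreover have "card V * (d * (d - 1) * (d - 2)) \<le> 6 * ?M"
  proof -
    have "(\<Sum>v\<in>V. d * (d - 1) * (d - 2)) \<le> (\<Sum>v\<in>V. 6 * (\<Sum>x\<in>nbrs v. card (left v x) * card (right v x)))"
      using star_count by (intro sum_mono) simp
    then show ?thesis by (simp add: sum_darts_star sum_distrib_left)
  qed
  ultimately have "3 * int (card {(a, b, c, e) \<in> disjoint_pairs. cross a b c e}) \<le>
      3 * int (card disjoint_pairs) - 2 * int (card V * (d * (d - 1) * (d - 2)))"
    using card_disjoint_pairs_split by linarith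
  then show ?thesis
    using extremal_value_identity[OF _ card_disjoint_pairs] False by simp
qed

text \<open>Each of the first three hypotheses removes one loss of the upper bound:
  \<open>balanced\<close> kills the squares, \<open>closed\<close> makes every separating connection
  an edge, and \<open>pointed\<close> excludes surrounding triples.\<close>

lemma crossing_pairs_eq:
  assumes balanced: "\<And>a c. adj a c \<Longrightarrow> card (left a c) = card (right c a)"
    and closed: "\<And>a b c e. \<lbrakk>adj a b; adj c e; distinct [a, b, c, e]; separated a c b e\<rbrakk> \<Longrightarrow> adj a c"
    and pointed: "\<And>v x y z. \<lbrakk>{v, x, y, z} \<subseteq> V; distinct [v, x, y, z]\<rbrakk> \<Longrightarrow>
      \<not> (ccw v x y = ccw v y z \<and> ccw v y z = ccw v z x)"
    and "0 < d"
  shows "3 * int (card {(a, b, c, e) \<in> disjoint_pairs. cross a b c e}) =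
    int (card V) * int d * (3 * int (card V) * int d - 2 * (int d)\<^sup>2 - 6 * int d + 2)"
proof -
  let ?W = "{(a, b, c, e) \<in> disjoint_pairs. separated a c b e}"
  let ?T = "{(a, b, c, e) \<in> disjoint_pairs. adj a c \<and> separated a c b e}"
  let ?M = "\<Sum>(a, c)\<in>darts. card (left a c) * card (right a c)"
  have "?T = ?W" using closed by (auto simp: disjoint_pairs_def)
  then have "card ?T = card ?W" by simp
  moreover have "2 * int ?M = int (card ?T)"
    unfolding card_separated_with_edge_imbalance imbalance_def
    using balanced by (auto simp: mem_darts intro: sum.neutral)
  moreover have "card V * (d * (d - 1) * (d - 2)) = 6 * ?M"
  proof -
    have "{(x, y, z) \<in> nbr_triples v. ccw v x y = ccw v y z \<and> ccw v y z = ccw v z x} = {}" for v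
      using pointed adj_V adj_sym adj_irrefl by (auto simp: nbr_triples_def) metis+
    then have "card {(x, y, z) \<in> nbr_triples v. ccw v x y = ccw v y z \<and> ccw v y z = ccw v z x} = 0" for v
      by (metis card.empty)
    then have "(\<Sum>v\<in>V. d * (d - 1) * (d - 2)) = (\<Sum>v\<in>V. 6 * (\<Sum>x\<in>nbrs v. card (left v x) * card (right v x)))"
      using star_count by (intro sum.cong) simp_all
    then show ?thesis by (simp add: sum_darts_star sum_distrib_left)
  qed
  ultimately have "3 * int (card {(a, b, c, e) \<in> disjoint_pairs. cross a b c e}) =
      3 * int (card disjoint_pairs) - 2 * int (card V * (d * (d - 1) * (d - 2)))"
    using card_disjoint_pairs_split by linarith
  then show ?thesis
    using extremal_value_identity[OF assms(4) card_disjoint_pairs] by simp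
qed

end

section \<open>Rectilinear drawings\<close>

text \<open>Twice the signed area of the triangle, positive for a counterclockwise one.\<close>

definition orient :: "real^2 \<Rightarrow> real^2 \<Rightarrow> real^2 \<Rightarrow> real" where
  "orient a b c = (b$1 - a$1) * (c$2 - a$2) - (b$2 - a$2) * (c$1 - a$1)"

lemma orient_rotate: "orient a b c = orient b c a"
  unfolding orient_def by algebra

lemma orient_swap: "orient b a c = - orient a b c"
  unfolding orient_def by algebra

text \<open>Signed areas add up; this is the source of the axiom
  \<open>ccw_interior\<close>.\<close>

lemma orient_sum: "orient a b c = orient a b t + orient b c t + orient c a t"
  unfolding orient_def by algebra

lemma orient_degenerate [simp]: "orient a a c = 0" "orient a b a = 0" "orient a b b = 0"
  unfolding orient_def by algebra+

lemma orient_convex_comb: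
  "orient a b ((1 - t) *\<^sub>R c + t *\<^sub>R e) = (1 - t) * orient a b c + t * orient a b e"
  unfolding orient_def by (simp add: algebra_simps)

definition proper_crossing :: "real^2 \<Rightarrow> real^2 \<Rightarrow> real^2 \<Rightarrow> real^2 \<Rightarrow> bool" where
  "proper_crossing a b c e \<longleftrightarrow>
     orient a b c * orient a b e < 0 \<and> orient c e a * orient c e b < 0"

lemma proper_crossing_swap:
  "proper_crossing b a c e \<longleftrightarrow> proper_crossing a b c e"
  "proper_crossing a b e c \<longleftrightarrow> proper_crossing a b c e"
  "proper_crossing c e a b \<longleftrightarrow> proper_crossing a b c e"
  unfolding proper_crossing_def orient_swap[of b a] orient_swap[of e c]
  by (auto simp: mult.commute)

lemma proper_crossing_distinct:
  "proper_crossing a b c e \<Longrightarrow> distinct [a, b, c, e]"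
  unfolding proper_crossing_def by auto

lemma proper_crossing_meet:
  assumes "proper_crossing a b c e"
  obtains x where "x \<in> closed_segment a b" "x \<in> closed_segment c e"
proof -
  define A B C D where "A = orient a b c" and "B = orient a b e"
    and "C = orient c e a" and "D = orient c e b"
  note defs = A_def B_def C_def D_def
  have AB: "A * B < 0" and CD: "C * D < 0"
    using assms by (simp_all add: proper_crossing_def defs)
  have rel: "C - D = B - A"
    unfolding defs orient_def by algebra
  have coord: "D * a$i - C * b$i = A * e$i - B * c$i" for i :: 2
    using exhaust_2[of i] unfolding defs orient_def by (elim disjE) (simp_all add: algebra_simps)
  have nz: "A - B \<noteq> 0" "C - D \<noteq> 0"
    using AB rel by (auto simp: mult_less_0_iff)
  \<comment> \<open>Along \<open>a b\<close> the orientation against \<open>c e\<close> is affine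
    and runs from \<open>C\<close> to \<open>D\<close>, so it vanishes at \<open>?u\<close>. In the
    same way the orientation against \<open>a b\<close> vanishes on \<open>c e\<close> at
    \<open>?t\<close>.\<close>
  let ?u = "C / (C - D)" and ?t = "A / (A - B)"
  have u: "0 \<le> ?u" "?u \<le> 1" and t: "0 \<le> ?t" "?t \<le> 1"
    using AB CD by (auto simp: mult_less_0_iff divide_simps)
  have "(1 - ?u) *\<^sub>R a + ?u *\<^sub>R b = (1 - ?t) *\<^sub>R c + ?t *\<^sub>R e"
  proof (subst vec_eq_iff, rule allI)
    fix i :: 2
    have comp: "1 - ?u = - D / (C - D)" "1 - ?t = - B / (A - B)"
      using nz by (simp_all add: field_simps)
    have "(1 - ?u) * a$i + ?u * b$i = (C * b$i - D * a$i) / (C - D)"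
      unfolding comp by (simp add: diff_divide_distrib mult.commute)
    also have "\<dots> = (A * e$i - B * c$i) / (A - B)"
    proof -
      have "C - D = - (A - B)" "C * b$i - D * a$i = - (A * e$i - B * c$i)"
        using coord[of i] rel by linarith+
      then show ?thesis by (simp only: minus_divide_divide)
    qed
    also have "\<dots> = (1 - ?t) * c$i + ?t * e$i"
      unfolding comp by (simp add: diff_divide_distrib mult.commute)
    finally show "((1 - ?u) *\<^sub>R a + ?u *\<^sub>R b) $ i = ((1 - ?t) *\<^sub>R c + ?t *\<^sub>R e) $ i"
      by simp
  qed
  then show ?thesis
    using that[of "(1 - ?u) *\<^sub>R a + ?u *\<^sub>R b"] u t unfolding in_segment by metis
qed

lemma parallel_scaleR:
  fixes a b c e :: "real^2"
  assumes "a \<noteq> b" and "orient a b c = orient a b e"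
  obtains k where "e - c = k *\<^sub>R (b - a)"
proof -
  have eq: "(b$1 - a$1) * (e$2 - c$2) = (b$2 - a$2) * (e$1 - c$1)"
    using assms(2) unfolding orient_def by algebra
  show ?thesis
  proof (cases "b$1 = a$1")
    case True
    then have "b$2 \<noteq> a$2" using assms(1) by (auto simp: vec_eq_iff forall_2)
    moreover from this have "e$1 = c$1" using eq True by simp
    ultimately show ?thesis
      using True by (intro that[of "(e$2 - c$2) / (b$2 - a$2)"]) (simp add: vec_eq_iff forall_2)
  next
    case False
    then have "e$2 - c$2 = (b$2 - a$2) * (e$1 - c$1) / (b$1 - a$1)"
      using eq by (simp add: eq_divide_eq mult.commute)
    then show ?thesis
      using False by (intro that[of "(e$1 - c$1) / (b$1 - a$1)"]) (simp add: vec_eq_iff forall_2 mult.commute)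
  qed
qed

text \<open>Equal orientations make the segments parallel. Sharing an inner point, they would then
  overlap in a whole interval.\<close>

lemma orient_unequal_if_meet_once:
  assumes "a \<noteq> b" "c \<noteq> e" and x: "x \<in> open_segment a b" "x \<in> open_segment c e"
    and once: "closed_segment a b \<inter> closed_segment c e = {x}"
  shows "orient a b c \<noteq> orient a b e"
proof
  assume "orient a b c = orient a b e"
  then obtain k where k: "e - c = k *\<^sub>R (b - a)"
    using parallel_scaleR assms(1) by blast
  then have "k \<noteq> 0" using assms(2) by auto
  obtain u where u: "0 < u" "u < 1" "x = (1 - u) *\<^sub>R a + u *\<^sub>R b"
    using x(1) by (auto simp: in_segment)
  obtain t where t: "0 < t" "t < 1" "x = (1 - t) *\<^sub>R c + t *\<^sub>R e"
    using x(2) by (auto simp: in_segment)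
  \<comment> \<open>A move by the fraction \<delta> along \<open>c e\<close> is a move by
    \<open>\<delta> * k\<close> along \<open>a b\<close>. The two bounds keep both parameters in the
    unit interval.\<close>
  define \<delta> where "\<delta> = min (1 - t) (min u (1 - u) / \<bar>k\<bar>)"
  have \<delta>: "0 < \<delta>" "\<delta> \<le> 1 - t"
    using u t \<open>k \<noteq> 0\<close> by (auto simp: \<delta>_def)
  have "\<delta> \<le> min u (1 - u) / \<bar>k\<bar>"
    unfolding \<delta>_def by (rule min.cobounded2)
  then have "\<delta> * \<bar>k\<bar> \<le> min u (1 - u)"
    by (rule iffD1[OF pos_le_divide_eq, rotated]) (use \<open>k \<noteq> 0\<close> in simp)
  then have "\<bar>\<delta> * k\<bar> \<le> min u (1 - u)" using \<delta> by (simp add: abs_mult)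
  then have range: "0 \<le> u + \<delta> * k" "u + \<delta> * k \<le> 1" by linarith+
  have "x + \<delta> *\<^sub>R (e - c) = (1 - (t + \<delta>)) *\<^sub>R c + (t + \<delta>) *\<^sub>R e"
    unfolding t(3) by (simp add: algebra_simps)
  then have "x + \<delta> *\<^sub>R (e - c) \<in> closed_segment c e"
    unfolding in_segment using \<delta> t by (intro exI[of _ "t + \<delta>"]) auto
  moreover have "x + \<delta> *\<^sub>R (e - c) = (1 - (u + \<delta> * k)) *\<^sub>R a + (u + \<delta> * k) *\<^sub>R b"
    unfolding k u(3) by (simp add: algebra_simps)
  then have "x + \<delta> *\<^sub>R (e - c) \<in> closed_segment a b"
    unfolding in_segment using range by (intro exI[of _ "u + \<delta> * k"]) auto
  ultimately have "x + \<delta> *\<^sub>R (e - c) = x" using once by blast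
  then show False using \<delta> assms(2) by simp
qed

text \<open>The orientation is affine along \<open>c e\<close> and zero at the inner point
  \<open>x\<close>. Its end values, being unequal, have opposite signs.\<close>

lemma orient_opposite_if_meet_once:
  assumes "a \<noteq> b" "c \<noteq> e" and x: "x \<in> open_segment a b" "x \<in> open_segment c e"
    and once: "closed_segment a b \<inter> closed_segment c e = {x}"
  shows "orient a b c * orient a b e < 0"
proof -
  obtain u where u: "x = (1 - u) *\<^sub>R a + u *\<^sub>R b"
    using x(1) by (auto simp: in_segment)
  obtain t where t: "0 < t" "t < 1" "x = (1 - t) *\<^sub>R c + t *\<^sub>R e"
    using x(2) by (auto simp: in_segment)
  have "orient a b x = 0" unfolding u orient_convex_comb by simp
  then have 0: "(1 - t) * orient a b c + t * orient a b e = 0"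
    unfolding t(3) orient_convex_comb .
  have ne: "orient a b c \<noteq> orient a b e" by (rule orient_unequal_if_meet_once[OF assms])
  have "orient a b c \<noteq> 0" using 0 ne t by auto
  have "orient a b e = - ((1 - t) * orient a b c) / t"
    using 0 t by (simp add: field_simps)
  then have "orient a b c * orient a b e = - ((1 - t) / t * (orient a b c)\<^sup>2)"
    by (simp add: power2_eq_square)
  also have "\<dots> < 0" using t \<open>orient a b c \<noteq> 0\<close> by simp
  finally show ?thesis .
qed

lemma proper_crossing_if_meet_once:
  assumes "a \<noteq> b" "c \<noteq> e" "x \<notin> {a, b, c, e}"
    and once: "closed_segment a b \<inter> closed_segment c e = {x}"
  shows "proper_crossing a b c e"
proof -
  have "x \<in> open_segment a b" "x \<in> open_segment c e"
    using assms by (auto simp: open_segment_def)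
  then show ?thesis
    using orient_opposite_if_meet_once[of a b c e x] orient_opposite_if_meet_once[of c e a b x] assms
    unfolding proper_crossing_def by (simp add: Int_commute)
qed

section \<open>Crossing points versus ordered quadruples of vertices\<close>

definition crossing_quads :: "'a set set \<Rightarrow> ('a \<Rightarrow> real^2) \<Rightarrow> ('a \<times> 'a \<times> 'a \<times> 'a) set" where
  "crossing_quads E p =
     {(a, b, c, e). {a, b} \<in> E \<and> {c, e} \<in> E \<and> proper_crossing (p a) (p b) (p c) (p e)}"

definition cross_at :: "'a set set \<Rightarrow> ('a \<Rightarrow> real^2) \<Rightarrow> real^2 \<Rightarrow> 'a \<Rightarrow> 'a \<Rightarrow> 'a \<Rightarrow> 'a \<Rightarrow> bool" where
  "cross_at E p x a b c e \<longleftrightarrow>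
     {g \<in> E. x \<in> drawn_edge p g} = {{a, b}, {c, e}} \<and>
     drawn_edge p {a, b} \<inter> drawn_edge p {c, e} = {x}"

definition quads_at :: "'a set set \<Rightarrow> ('a \<Rightarrow> real^2) \<Rightarrow> real^2 \<Rightarrow> ('a \<times> 'a \<times> 'a \<times> 'a) set" where
  "quads_at E p x = {(a, b, c, e) \<in> crossing_quads E p. cross_at E p x a b c e}"

lemma finite_crossing_quads:
  assumes "simple_graph V E"
  shows "finite (crossing_quads E p)"
proof (rule finite_subset)
  show "crossing_quads E p \<subseteq> V \<times> V \<times> V \<times> V"
    using assms by (auto simp: crossing_quads_def simple_graph_def)
qed (use assms in \<open>simp add: simple_graph_def\<close>)

lemma finite_quads_at:
  assumes "simple_graph V E"
  shows "finite (quads_at E p x)"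
  by (rule finite_subset[OF _ finite_crossing_quads[OF assms]]) (auto simp: quads_at_def)

lemma quads_at_disjoint:
  "x \<noteq> y \<Longrightarrow> quads_at E p x \<inter> quads_at E p y = {}"
  by (auto simp: quads_at_def cross_at_def)

text \<open>The two edges share no vertex: its image would be their only common point
  \<open>x\<close>, which is not a vertex. Hence the eight ordered forms of the pair are
  distinct.\<close>

lemma card_quads_at_ge:
  assumes G: "simple_graph V E" and inj: "inj_on p V" and x: "x \<in> crossings V E p"
  shows "8 \<le> card (quads_at E p x)"
proof -
  obtain g h where gh: "g \<noteq> h" and all: "{f \<in> E. x \<in> drawn_edge p f} = {g, h}"
    and once: "drawn_edge p g \<inter> drawn_edge p h = {x}" and nv: "x \<notin> p ` V"
    using x unfolding crossings_def by (elim CollectE conjE exE) (rule that; assumption)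
  have "g \<in> E" "h \<in> E" using all by blast+
  then obtain a b c e where g: "g = {a, b}" "a \<noteq> b" and h: "h = {c, e}" "c \<noteq> e"
    and V: "a \<in> V" "b \<in> V" "c \<in> V" "e \<in> V"
    using G unfolding simple_graph_def card_2_iff by (metis insert_subset)
  have in_drawn: "p v \<in> drawn_edge p f" if "v \<in> f" for v f
    unfolding drawn_edge_def using that by (simp add: hull_inc)
  have "v \<notin> h" if "v \<in> g" for v
  proof
    assume "v \<in> h"
    then have "p v = x" using in_drawn[OF that] in_drawn[of v h] once by blast
    then show False using nv V that g(1) by auto
  qed
  then have dist: "distinct [a, b, c, e]" using g h by auto
  have "proper_crossing (p a) (p b) (p c) (p e)"
  proof (rule proper_crossing_if_meet_once)
    show "p a \<noteq> p b" "p c \<noteq> p e" using inj V dist by (auto dest: inj_onD)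
    show "x \<notin> {p a, p b, p c, p e}" using nv V by blast
    show "closed_segment (p a) (p b) \<inter> closed_segment (p c) (p e) = {x}"
      using once unfolding g h drawn_edge_closed_segment .
  qed
  moreover have "{b, a} = {a, b}" "{e, c} = {c, e}" by auto
  ultimately have sub: "{(a, b, c, e), (b, a, c, e), (a, b, e, c), (b, a, e, c),
      (c, e, a, b), (e, c, a, b), (c, e, b, a), (e, c, b, a)} \<subseteq> quads_at E p x" (is "?S \<subseteq> _")
    using all once \<open>g \<in> E\<close> \<open>h \<in> E\<close> unfolding g h
    by (simp add: quads_at_def cross_at_def crossing_quads_def proper_crossing_swap Int_commute
        insert_commute)
  have "card ?S = 8" using dist by simp
  then show ?thesis using card_mono[OF finite_quads_at[OF G] sub] by simp
qed

text \<open>\<open>cross_at\<close> determines the unordered pair of edges from \<open>x\<close>,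
  leaving eight ways to order it.\<close>

lemma card_quads_at_le:
  "card (quads_at E p x) \<le> 8"
proof (cases "quads_at E p x = {}")
  case False
  then obtain a b c e where q: "cross_at E p x a b c e"
    by (auto simp: quads_at_def)
  let ?S = "{(a, b, c, e), (b, a, c, e), (a, b, e, c), (b, a, e, c),
      (c, e, a, b), (e, c, a, b), (c, e, b, a), (e, c, b, a)}"
  have "quads_at E p x \<subseteq> ?S"
  proof
    fix r assume "r \<in> quads_at E p x"
    then obtain a' b' c' e' where r: "r = (a', b', c', e')" and "(a', b', c', e') \<in> quads_at E p x"
      by (cases r) auto
    then have "{{a', b'}, {c', e'}} = {{a, b}, {c, e}}"
      using q unfolding quads_at_def cross_at_def by simp
    then have "{a', b'} = {a, b} \<and> {c', e'} = {c, e} \<or> {a', b'} = {c, e} \<and> {c', e'} = {a, b}"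
      by (simp only: doubleton_eq_iff)
    then show "r \<in> ?S"
      unfolding r doubleton_eq_iff by (elim disjE conjE; simp)
  qed
  then have "card (quads_at E p x) \<le> card ?S"
    by (intro card_mono) auto
  also have "\<dots> \<le> 8"
    using card_length[of "[(a, b, c, e), (b, a, c, e), (a, b, e, c), (b, a, e, c),
      (c, e, a, b), (e, c, a, b), (c, e, b, a), (e, c, b, a)]"] by simp
  finally show ?thesis .
qed simp

text \<open>Only an inequality, since a point on three edges yields quadruples but is not a
  crossing.\<close>

lemma eight_crossings_le:
  assumes G: "simple_graph V E" and "inj_on p V"
  shows "8 * card (crossings V E p) \<le> card (crossing_quads E p)"
proof -
  let ?C = "crossings V E p"
  have fin: "finite ?C" by (rule crossings_bound(1)[OF simple_graph_finite_edges(1)[OF G]])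
  have "8 * card ?C = (\<Sum>x\<in>?C. 8)" by simp
  also have "\<dots> \<le> (\<Sum>x\<in>?C. card (quads_at E p x))"
    using card_quads_at_ge[OF assms] by (intro sum_mono) auto
  also have "\<dots> = card (\<Union>x\<in>?C. quads_at E p x)"
    using fin finite_quads_at[OF G] quads_at_disjoint
    by (intro card_UN_disjoint[symmetric] ballI impI) simp_all
  also have "\<dots> \<le> card (crossing_quads E p)"
    by (intro card_mono finite_crossing_quads[OF G]) (auto simp: quads_at_def)
  finally show ?thesis .
qed

text \<open>The converse estimate, for drawings in which each proper crossing yields a counted
  point.\<close>

lemma crossing_quads_le:
  assumes G: "simple_graph V E"
    and cross: "\<And>a b c e. (a, b, c, e) \<in> crossing_quads E p \<Longrightarrow> \<exists>x. x \<notin> p ` V \<and> cross_at E p x a b c e"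
  shows "card (crossing_quads E p) \<le> 8 * card (crossings V E p)"
proof -
  let ?C = "crossings V E p"
  have fin: "finite ?C" by (rule crossings_bound(1)[OF simple_graph_finite_edges(1)[OF G]])
  have "crossing_quads E p \<subseteq> (\<Union>x\<in>?C. quads_at E p x)"
  proof
    fix q assume q: "q \<in> crossing_quads E p"
    then obtain a b c e where abce: "q = (a, b, c, e)" by (cases q)
    then obtain x where x: "x \<notin> p ` V" "cross_at E p x a b c e" using cross q by blast
    have "distinct [p a, p b, p c, p e]"
      using q proper_crossing_distinct unfolding abce crossing_quads_def by blast
    then have "{a, b} \<noteq> {c, e}" by (auto simp: doubleton_eq_iff)
    then have "x \<in> ?C"
      using x unfolding crossings_def cross_at_def
      by (intro CollectI conjI exI[of _ "{a, b}"] exI[of _ "{c, e}"]) simp_all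
    then show "q \<in> (\<Union>x\<in>?C. quads_at E p x)"
      using x q abce by (auto simp: quads_at_def)
  qed
  then have "card (crossing_quads E p) \<le> card (\<Union>x\<in>?C. quads_at E p x)"
    using fin finite_quads_at[OF G] by (intro card_mono) auto
  also have "\<dots> \<le> (\<Sum>x\<in>?C. card (quads_at E p x))"
    by (rule card_UN_le[OF fin])
  also have "\<dots> \<le> (\<Sum>x\<in>?C. 8)"
    using card_quads_at_le by (rule sum_mono)
  finally show ?thesis by simp
qed

section \<open>Perturbation into general position\<close>

lemma eventually_quadratic_sign:
  fixes o0 o1 o2 :: real
  assumes "o2 \<noteq> 0"
  shows "\<forall>\<^sub>F h in at_right 0. let q = o0 + h * o1 + h\<^sup>2 * o2 in
    q \<noteq> 0 \<and> (0 < o0 \<longrightarrow> 0 < q) \<and> (o0 < 0 \<longrightarrow> q < 0)"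
proof -
  have nonzero: "\<forall>\<^sub>F h in at_right 0. f h \<noteq> 0" if "(f \<longlongrightarrow> c) (at_right 0)" "c \<noteq> 0" for f :: "real \<Rightarrow> real" and c
    using tendsto_imp_eventually_ne[OF that] .
  have lim: "((\<lambda>h. o0 + h * o1 + h\<^sup>2 * o2) \<longlongrightarrow> o0 + 0 * o1 + 0\<^sup>2 * o2) (at_right 0)"
    by (intro tendsto_intros)
  have lim1: "((\<lambda>h. o1 + h * o2) \<longlongrightarrow> o1 + 0 * o2) (at_right 0)"
    by (intro tendsto_intros)
  have pos: "\<forall>\<^sub>F h in at_right (0::real). 0 < h" by (rule eventually_at_right_less)
  \<comment> \<open>A nonzero constant term fixes the sign for small \<open>h\<close>. Otherwise a
    power of \<open>h\<close> splits off and the first nonzero coefficient keeps the value away from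
    zero.\<close>
  consider "0 < o0" | "o0 < 0" | "o0 = 0" "o1 \<noteq> 0" | "o0 = 0" "o1 = 0" by linarith
  then show ?thesis
  proof cases
    case 1
    then have "\<forall>\<^sub>F h in at_right 0. 0 < o0 + h * o1 + h\<^sup>2 * o2"
      using order_tendstoD(1)[OF lim, of 0] by simp
    then show ?thesis by eventually_elim (use 1 in \<open>simp add: Let_def\<close>)
  next
    case 2
    then have "\<forall>\<^sub>F h in at_right 0. o0 + h * o1 + h\<^sup>2 * o2 < 0"
      using order_tendstoD(2)[OF lim, of 0] by simp
    then show ?thesis by eventually_elim (use 2 in \<open>simp add: Let_def\<close>)
  next
    case 3
    have "\<forall>\<^sub>F h in at_right 0. o1 + h * o2 \<noteq> 0"
      using nonzero[OF lim1] 3 by simp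
    then show ?thesis using pos
    proof eventually_elim
      case (elim h)
      have "o0 + h * o1 + h\<^sup>2 * o2 = h * (o1 + h * o2)"
        using 3 by (simp add: algebra_simps power2_eq_square)
      then show ?case using elim 3 by (simp add: Let_def)
    qed
  next
    case 4
    show ?thesis using pos by eventually_elim (use 4 assms in \<open>simp add: Let_def\<close>)
  qed
qed

text \<open>Moving vertex \<open>v\<close> by \<open>h (v, v\<^sup>2)\<close> changes each orientation determinant to a polynomial in
  \<open>h\<close> whose leading coefficient is a Vandermonde determinant.\<close>

lemma general_position_perturbation:
  fixes V :: "nat set" and p :: "nat \<Rightarrow> real^2"
  assumes "finite V"
  obtains q :: "nat \<Rightarrow> real^2" where
    "\<And>a b c. \<lbrakk>a \<in> V; b \<in> V; c \<in> V; distinct [a, b, c]\<rbrakk> \<Longrightarrow> orient (q a) (q b) (q c) \<noteq> 0"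
    "\<And>a b c e. \<lbrakk>{a, b, c, e} \<subseteq> V; proper_crossing (p a) (p b) (p c) (p e)\<rbrakk> \<Longrightarrow>
      proper_crossing (q a) (q b) (q c) (q e)"
proof -
  define q :: "real \<Rightarrow> nat \<Rightarrow> real^2"
    where "q h v = p v + h *\<^sub>R vector [real v, (real v)\<^sup>2]" for h v
  define good where "good h a b c \<longleftrightarrow>
      (let o0 = orient (p a) (p b) (p c); o1 = orient (q h a) (q h b) (q h c) in
       o1 \<noteq> 0 \<and> (0 < o0 \<longrightarrow> 0 < o1) \<and> (o0 < 0 \<longrightarrow> o1 < 0))" for h a b c
  have "\<forall>\<^sub>F h in at_right 0. good h a b c" if "distinct [a, b, c]" for a b c
  proof -
    let ?t = "\<lambda>v. real v" and ?x = "\<lambda>v. p v $ 1" and ?y = "\<lambda>v. p v $ 2"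
    define o1 where "o1 = (?t b - ?t a) * (?y c - ?y a) + (?x b - ?x a) * ((?t c)\<^sup>2 - (?t a)\<^sup>2)
      - ((?t b)\<^sup>2 - (?t a)\<^sup>2) * (?x c - ?x a) - (?y b - ?y a) * (?t c - ?t a)"
    define o2 where "o2 = (?t b - ?t a) * (?t c - ?t a) * (?t c - ?t b)"
    have "orient (q h a) (q h b) (q h c) = orient (p a) (p b) (p c) + h * o1 + h\<^sup>2 * o2" for h
      unfolding orient_def q_def o1_def o2_def vector_add_component vector_scaleR_component vector_2
      by (simp only: real_scaleR_def) algebra
    moreover have "o2 \<noteq> 0" using that by (simp add: o2_def)
    ultimately show ?thesis
      using eventually_quadratic_sign[of o2 "orient (p a) (p b) (p c)" o1]
      by (simp add: good_def Let_def)
  qed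
  then have "\<forall>\<^sub>F h in at_right 0. distinct [a, b, c] \<longrightarrow> good h a b c" for a b c
    by (cases "distinct [a, b, c]") simp_all
  then have "\<forall>\<^sub>F h in at_right 0. \<forall>a\<in>V. \<forall>b\<in>V. \<forall>c\<in>V. distinct [a, b, c] \<longrightarrow> good h a b c"
    by (intro eventually_ball_finite ballI assms)
  then obtain h where h: "\<forall>a\<in>V. \<forall>b\<in>V. \<forall>c\<in>V. distinct [a, b, c] \<longrightarrow> good h a b c"
    using eventually_happens'[OF trivial_limit_at_right_real] by blast
  then have good: "good h a b c" if "a \<in> V" "b \<in> V" "c \<in> V" "distinct [a, b, c]" for a b c
    using that by blast
  show ?thesis
  proof (rule that[of "q h"])
    show "orient (q h a) (q h b) (q h c) \<noteq> 0" if "a \<in> V" "b \<in> V" "c \<in> V" "distinct [a, b, c]" for a b c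
      using good[OF that] by (simp add: good_def Let_def)
    show "proper_crossing (q h a) (q h b) (q h c) (q h e)"
      if V: "{a, b, c, e} \<subseteq> V" and pc: "proper_crossing (p a) (p b) (p c) (p e)" for a b c e
    proof -
      have "distinct [a, b, c, e]" using proper_crossing_distinct[OF pc] by auto
      then have "good h a b c" "good h a b e" "good h c e a" "good h c e b"
        using good V by auto
      then show ?thesis
        using pc unfolding proper_crossing_def good_def Let_def by (auto simp: mult_less_0_iff)
    qed
  qed
qed

section \<open>An extremal drawing on a parabola\<close>

text \<open>Uniqueness of binary representations on two levels: each sum is the
  \<open>set_encode\<close> of a set whose members are themselves codes.\<close>

lemma sum_pow_set_encode_inject:
  assumes "finite \<A>" "finite \<B>" "\<A> \<subseteq> {S. finite S}" "\<B> \<subseteq> {S. finite S}"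
    and eq: "(\<Sum>S\<in>\<A>. 2 ^ set_encode S) = (\<Sum>S\<in>\<B>. 2 ^ set_encode S :: nat)"
  shows "\<A> = \<B>"
proof -
  have inj: "inj_on set_encode {S. finite S}"
    by (rule inj_on_set_encode)
  have enc: "(\<Sum>S\<in>\<C>. 2 ^ set_encode S) = set_encode (set_encode ` \<C>)" if "\<C> \<subseteq> {S. finite S}" for \<C>
    using inj_on_subset[OF inj that]
    by (simp add: set_encode_def[THEN fun_cong, of "set_encode ` \<C>"] sum.reindex)
  have "set_encode ` \<A> = set_encode ` \<B>"
    using eq enc[OF assms(3)] enc[OF assms(4)] assms(1,2) by (intro inj_onD[OF inj]) simp_all
  then show ?thesis
    using inj_on_image_eq_iff[OF inj assms(3,4)] by simp
qed

lemma binary_sums_neq: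
  assumes "distinct [a, b, c, e, f, h]"
  shows "(\<Sum>S\<in>{{c, f, h}, {e, f, h}, {a, c, e}, {b, c, e}, {f, a, b}, {h, a, b}}. 2 ^ set_encode S) \<noteq>
    (\<Sum>S\<in>{{f, c, e}, {h, c, e}, {a, f, h}, {b, f, h}, {c, a, b}, {e, a, b}}. 2 ^ set_encode S :: nat)"
proof
  assume "(\<Sum>S\<in>{{c, f, h}, {e, f, h}, {a, c, e}, {b, c, e}, {f, a, b}, {h, a, b}}. 2 ^ set_encode S) =
    (\<Sum>S\<in>{{f, c, e}, {h, c, e}, {a, f, h}, {b, f, h}, {c, a, b}, {e, a, b}}. 2 ^ set_encode S :: nat)"
  then have "{{c, f, h}, {e, f, h}, {a, c, e}, {b, c, e}, {f, a, b}, {h, a, b}} =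
    {{f, c, e}, {h, c, e}, {a, f, h}, {b, f, h}, {c, a, b}, {e, a, b}}" (is "?A = ?B")
    by (rule sum_pow_set_encode_inject[rotated 4]) simp_all
  \<comment> \<open>The set \<open>{c, f, h}\<close> belongs to the left family only.\<close>
  then have "{c, f, h} \<in> ?B" by (rule subst) simp
  then show False using assms by (auto simp: set_eq_subset)
qed

text \<open>The doubly exponential abscissae keep any three vertex-disjoint chords from being concurrent.\<close>

definition abscissa :: "nat \<Rightarrow> nat" where
  "abscissa i = 2 ^ 2 ^ i"

definition parabola :: "nat \<Rightarrow> real^2" where
  "parabola i = vector [real (abscissa i), (real (abscissa i))\<^sup>2]"

lemma abscissa_less_iff [simp]: "abscissa i < abscissa j \<longleftrightarrow> i < j"
  by (simp add: abscissa_def)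

lemma abscissa_eq_iff [simp]: "abscissa i = abscissa j \<longleftrightarrow> i = j"
  by (simp add: abscissa_def)

lemma parabola_eq_iff [simp]: "parabola i = parabola j \<longleftrightarrow> i = j"
  by (auto simp: parabola_def vec_eq_iff forall_2)

lemma abscissa_product:
  assumes "distinct [a, b, c]"
  shows "abscissa a * abscissa b * abscissa c = 2 ^ set_encode {a, b, c}"
  using assms by (simp add: abscissa_def set_encode_def power_add)

text \<open>Expanding the concurrency determinant gives a signed sum of twelve distinct powers of 2,
  which is nonzero since binary representations are unique.\<close>

lemma abscissa_products_neq:
  fixes a b c e f h :: nat
  defines "X \<equiv> abscissa"
  assumes "distinct [a, b, c, e, f, h]"
  shows "(X c + X e) * (X f * X h) + (X a + X b) * (X c * X e) + (X f + X h) * (X a * X b) \<noteq>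
    (X f + X h) * (X c * X e) + (X a + X b) * (X f * X h) + (X c + X e) * (X a * X b)"
proof -
  let ?p = "\<lambda>S. 2 ^ set_encode S :: nat"
  have ineqs: "a \<noteq> b" "a \<noteq> c" "a \<noteq> e" "a \<noteq> f" "a \<noteq> h" "b \<noteq> c" "b \<noteq> e" "b \<noteq> f" "b \<noteq> h"
    "c \<noteq> e" "c \<noteq> f" "c \<noteq> h" "e \<noteq> f" "e \<noteq> h" "f \<noteq> h"
    using assms(2) by simp_all
  have "(X c + X e) * (X f * X h) + (X a + X b) * (X c * X e) + (X f + X h) * (X a * X b) =
    X c * X f * X h + (X e * X f * X h + (X a * X c * X e + (X b * X c * X e +
      (X f * X a * X b + X h * X a * X b))))"
    by (simp add: algebra_simps)
  also have "\<dots> = sum ?p {{c, f, h}, {e, f, h}, {a, c, e}, {b, c, e}, {f, a, b}, {h, a, b}}"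
    by (simp add: X_def abscissa_product set_eq_subset ineqs ineqs[symmetric])
  finally have 1: "(X c + X e) * (X f * X h) + (X a + X b) * (X c * X e) + (X f + X h) * (X a * X b) =
      sum ?p {{c, f, h}, {e, f, h}, {a, c, e}, {b, c, e}, {f, a, b}, {h, a, b}}" .
  have "(X f + X h) * (X c * X e) + (X a + X b) * (X f * X h) + (X c + X e) * (X a * X b) =
    X f * X c * X e + (X h * X c * X e + (X a * X f * X h + (X b * X f * X h +
      (X c * X a * X b + X e * X a * X b))))"
    by (simp add: algebra_simps)
  also have "\<dots> = sum ?p {{f, c, e}, {h, c, e}, {a, f, h}, {b, f, h}, {c, a, b}, {e, a, b}}"
    by (simp add: X_def abscissa_product set_eq_subset ineqs ineqs[symmetric])
  finally have 2: "(X f + X h) * (X c * X e) + (X a + X b) * (X f * X h) + (X c + X e) * (X a * X b) =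
      sum ?p {{f, c, e}, {h, c, e}, {a, f, h}, {b, f, h}, {c, a, b}, {e, a, b}}" .
  show ?thesis unfolding 1 2 by (rule binary_sums_neq[OF assms(2)])
qed

section \<open>Secant lines of the parabola and their intersections\<close>

definition on_chord :: "nat \<Rightarrow> nat \<Rightarrow> real^2 \<Rightarrow> bool" where
  "on_chord a b x \<longleftrightarrow> x$2 = (real (abscissa a) + real (abscissa b)) * x$1 - real (abscissa a) * real (abscissa b)"

lemma on_chord_commute: "on_chord a b x \<longleftrightarrow> on_chord b a x"
  by (simp add: on_chord_def algebra_simps)

lemma segment_on_chord:
  assumes "x \<in> closed_segment (parabola a) (parabola b)"
  shows "on_chord a b x"
proof -
  obtain u where "x = (1 - u) *\<^sub>R parabola a + u *\<^sub>R parabola b"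
    using assms by (auto simp: in_segment)
  then have "x$1 = (1 - u) * real (abscissa a) + u * real (abscissa b)"
    "x$2 = (1 - u) * (real (abscissa a))\<^sup>2 + u * (real (abscissa b))\<^sup>2"
    by (simp_all add: parabola_def)
  then show ?thesis
    unfolding on_chord_def by algebra
qed

lemma parabola_on_chord_iff: "on_chord a b (parabola v) \<longleftrightarrow> v = a \<or> v = b"
proof -
  have "on_chord a b (parabola v) \<longleftrightarrow>
      (real (abscissa v) - real (abscissa a)) * (real (abscissa v) - real (abscissa b)) = 0"
    unfolding on_chord_def parabola_def by (auto simp: algebra_simps power2_eq_square)
  then show ?thesis by simp
qed

lemma on_chords_shared_vertex:
  assumes "on_chord a b x" "on_chord a h x" "b \<noteq> h"
  shows "x = parabola a"
proof -
  have "(real (abscissa b) - real (abscissa h)) * (x$1 - real (abscissa a)) = 0"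
    using assms(1,2) unfolding on_chord_def by algebra
  then have "x$1 = real (abscissa a)" using assms(3) by simp
  with assms(1) show ?thesis
    by (auto simp: on_chord_def parabola_def vec_eq_iff forall_2 power2_eq_square algebra_simps)
qed

text \<open>Lines of different slope meet at most once. Equal slopes and the common point
  \<open>x\<close> would make the lines equal and put \<open>parabola a\<close> on the chord
  \<open>c e\<close>.\<close>

lemma on_chords_unique:
  assumes "on_chord a b x" "on_chord c e x" "on_chord a b y" "on_chord c e y" and dist: "distinct [a, b, c, e]"
  shows "x = y"
proof -
  let ?X = "\<lambda>i. real (abscissa i)"
  have "?X a + ?X b \<noteq> ?X c + ?X e"
  proof
    assume s: "?X a + ?X b = ?X c + ?X e"
    then have "?X a * ?X b = ?X c * ?X e"
      using assms(1,2) unfolding on_chord_def by simp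
    then have "on_chord c e (parabola a)"
      using s parabola_on_chord_iff[of a b a] unfolding on_chord_def by simp
    then show False using dist by (simp add: parabola_on_chord_iff)
  qed
  moreover have "(?X a + ?X b - (?X c + ?X e)) * (x$1 - y$1) = 0"
    using assms(1-4) unfolding on_chord_def by algebra
  ultimately have "x$1 = y$1" by simp
  moreover from this have "x$2 = y$2" using assms(1,3) unfolding on_chord_def by simp
  ultimately show ?thesis by (simp add: vec_eq_iff forall_2)
qed

text \<open>Eliminating the coordinates of \<open>x\<close> makes a determinant vanish. Its positive
  and negative terms stand on separate sides, so the equation carries over to
  \<open>nat\<close>.\<close>

lemma no_three_chords_concurrent:
  assumes "on_chord a b x" "on_chord c e x" "on_chord f h x" and dist: "distinct [a, b, c, e, f, h]"
  shows False
proof -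
  let ?X = "\<lambda>i. real (abscissa i)"
  have "(?X c + ?X e) * (?X f * ?X h) + (?X a + ?X b) * (?X c * ?X e) + (?X f + ?X h) * (?X a * ?X b) =
    (?X f + ?X h) * (?X c * ?X e) + (?X a + ?X b) * (?X f * ?X h) + (?X c + ?X e) * (?X a * ?X b)"
    using assms(1-3) unfolding on_chord_def by algebra
  then show False
    using abscissa_products_neq[OF dist] by (simp only: of_nat_add[symmetric] of_nat_mult[symmetric] of_nat_eq_iff)
qed

text \<open>A third edge through \<open>x\<close> would either be disjoint from both chords, giving
  three concurrent ones, or share an end with one of them. Distinct chords from a vertex meet only
  in that vertex, so the edge is then not new.\<close>

lemma parabola_crossing:
  assumes G: "simple_graph V E" and q: "(a, b, c, e) \<in> crossing_quads E parabola"
  shows "\<exists>x. x \<notin> parabola ` V \<and> cross_at E parabola x a b c e"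
proof -
  have E: "{a, b} \<in> E" "{c, e} \<in> E" and pc: "proper_crossing (parabola a) (parabola b) (parabola c) (parabola e)"
    using q by (auto simp: crossing_quads_def)
  have dist: "distinct [a, b, c, e]" using proper_crossing_distinct[OF pc] by auto
  obtain x where x: "x \<in> closed_segment (parabola a) (parabola b)" "x \<in> closed_segment (parabola c) (parabola e)"
    using proper_crossing_meet[OF pc] .
  then have on: "on_chord a b x" "on_chord c e x" by (simp_all add: segment_on_chord)
  have not_vertex: "x \<noteq> parabola v" for v
    using on dist parabola_on_chord_iff by auto
  have "g = {a, b} \<or> g = {c, e}" if "g \<in> E" "x \<in> drawn_edge parabola g" for g
  proof -
    obtain f h where g: "g = {f, h}" "f \<noteq> h"
      using G \<open>g \<in> E\<close> unfolding simple_graph_def by (metis card_2_iff)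
    then have fh: "on_chord f h x" "on_chord h f x"
      using that by (auto simp: drawn_edge_closed_segment segment_on_chord on_chord_commute[of h])
    have shared: "k = j" if "on_chord i j x" "on_chord i k x" for i j k
      using on_chords_shared_vertex[OF that] not_vertex by blast
    have on': "on_chord b a x" "on_chord e c x" using on on_chord_commute by blast+
    show ?thesis
    proof (cases "distinct [a, b, c, e, f, h]")
      case True
      then show ?thesis using no_three_chords_concurrent on fh by blast
    next
      case False
      then have "f \<in> {a, b, c, e} \<or> h \<in> {a, b, c, e}"
        using dist g(2) by simp blast
      moreover have "f = a \<Longrightarrow> h = b" "f = b \<Longrightarrow> h = a" "f = c \<Longrightarrow> h = e" "f = e \<Longrightarrow> h = c"
        using shared on on' fh(1) by blast+
      moreover have "h = a \<Longrightarrow> f = b" "h = b \<Longrightarrow> f = a" "h = c \<Longrightarrow> f = e" "h = e \<Longrightarrow> f = c"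
        using shared on on' fh(2) by blast+
      ultimately show ?thesis unfolding g doubleton_eq_iff by blast
    qed
  qed
  moreover have "x \<in> drawn_edge parabola {a, b}" "x \<in> drawn_edge parabola {c, e}"
    using x by (simp_all add: drawn_edge_closed_segment)
  ultimately have "{g \<in> E. x \<in> drawn_edge parabola g} = {{a, b}, {c, e}}"
    using E by auto
  moreover have "drawn_edge parabola {a, b} \<inter> drawn_edge parabola {c, e} = {x}"
    unfolding drawn_edge_closed_segment
    using x on segment_on_chord on_chords_unique[OF on _ _ dist] by blast
  ultimately show ?thesis using not_vertex unfolding cross_at_def by blast
qed

section \<open>Orientation on the parabola as cyclic order\<close>

definition cyclic :: "nat \<Rightarrow> nat \<Rightarrow> nat \<Rightarrow> bool" where
  "cyclic a b c \<longleftrightarrow> a < b \<and> b < c \<or> b < c \<and> c < a \<or> c < a \<and> a < b"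

lemma cyclic_swap: "distinct [a, b, c] \<Longrightarrow> cyclic b a c \<longleftrightarrow> \<not> cyclic a b c"
  unfolding cyclic_def by auto
lemma cyclic_rotate: "cyclic a b c \<longleftrightarrow> cyclic b c a"
  unfolding cyclic_def by auto
lemma cyclic_acyclic: "\<not> (cyclic v x y \<and> cyclic v y z \<and> cyclic v z x)"
  unfolding cyclic_def by linarith
text \<open>Cut at \<open>v\<close>, the cyclic order is linear, so it has no 3-cycle in either
  direction. This yields the hypothesis \<open>pointed\<close> of the equality case.\<close>

lemma cyclic_not_surrounded:
  assumes "distinct [v, x, y, z]"
  shows "\<not> (cyclic v x y = cyclic v y z \<and> cyclic v y z = cyclic v z x)"
proof -
  have "cyclic v y x \<longleftrightarrow> \<not> cyclic v x y" "cyclic v z y \<longleftrightarrow> \<not> cyclic v y z" "cyclic v x z \<longleftrightarrow> \<not> cyclic v z x"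
    using assms cyclic_swap[of x v y] cyclic_swap[of y v z] cyclic_swap[of z v x] cyclic_rotate
    by auto
  then show ?thesis using cyclic_acyclic[of v x y z] cyclic_acyclic[of v z y x] by blast
qed

text \<open>A Vandermonde determinant, so its sign depends only on the order of the indices.\<close>

lemma orient_parabola:
  "orient (parabola a) (parabola b) (parabola c) =
    (real (abscissa b) - real (abscissa a)) * (real (abscissa c) - real (abscissa a)) *
    (real (abscissa c) - real (abscissa b))"
  unfolding orient_def parabola_def vector_2 by algebra

lemma orient_parabola_pos_iff:
  "0 < orient (parabola a) (parabola b) (parabola c) \<longleftrightarrow> cyclic a b c"
  unfolding orient_parabola cyclic_def
  by (auto simp: zero_less_mult_iff mult_less_0_iff)

lemma orient_parabola_nonzero:
  "distinct [a, b, c] \<Longrightarrow> orient (parabola a) (parabola b) (parabola c) \<noteq> 0"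
  unfolding orient_parabola by simp

lemma card_incident_edges:
  assumes "simple_graph V E"
  shows "card {w. {v, w} \<in> E} = degree E v"
proof -
  have "bij_betw (\<lambda>w. {v, w}) {w. {v, w} \<in> E} {e \<in> E. v \<in> e}"
  proof (rule bij_betwI')
    fix e assume "e \<in> {e \<in> E. v \<in> e}"
    then have "e \<in> E" "v \<in> e" "card e = 2" using assms by (auto simp: simple_graph_def)
    then obtain w where "e = {v, w}"
      by (metis card_2_iff insertE insert_commute singletonD)
    then show "\<exists>w\<in>{w. {v, w} \<in> E}. e = {v, w}" using \<open>e \<in> E\<close> by blast
  qed (auto simp: doubleton_eq_iff)
  then show ?thesis unfolding degree_def by (rule bij_betw_same_card)
qed

lemma ccw_regular_graph_of_drawing:
  assumes "(V, E) \<in> regular_graphs n d"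
    and gp: "\<And>a b c. \<lbrakk>a \<in> V; b \<in> V; c \<in> V; distinct [a, b, c]\<rbrakk> \<Longrightarrow> orient (q a) (q b) (q c) \<noteq> 0"
  shows "ccw_regular_graph V (\<lambda>a b. {a, b} \<in> E) (\<lambda>a b c. 0 < orient (q a) (q b) (q c)) d"
proof
  have G: "simple_graph V E" and deg: "\<And>v. v \<in> V \<Longrightarrow> degree E v = d"
    using assms(1) by (auto simp: regular_graphs_def)
  show "finite V" using G by (simp add: simple_graph_def)
  show "a \<in> V" if "{a, b} \<in> E" for a b using G that by (auto simp: simple_graph_def)
  show "{b, a} \<in> E" if "{a, b} \<in> E" for a b using that by (simp add: insert_commute)
  show "{a, a} \<notin> E" for a using G by (auto simp: simple_graph_def)
  show "card {w. {v, w} \<in> E} = d" if "v \<in> V" for v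
    using card_incident_edges[OF G] deg[OF that] by simp
  show "0 < orient (q b) (q c) (q a)" if "0 < orient (q a) (q b) (q c)" for a b c
    using that orient_rotate by metis
  show "0 < orient (q b) (q a) (q c) \<longleftrightarrow> \<not> 0 < orient (q a) (q b) (q c)"
    if "a \<in> V" "b \<in> V" "c \<in> V" "distinct [a, b, c]" for a b c
    using gp[OF that] orient_swap[of "q b" "q a" "q c"] by linarith
  show "0 < orient (q a) (q b) (q c)"
    if "0 < orient (q a) (q b) (q t)" "0 < orient (q b) (q c) (q t)" "0 < orient (q c) (q a) (q t)" for a b c t
    using that orient_sum[of "q a" "q b" "q c" "q t"] by linarith
qed

section \<open>The upper bound for an arbitrary drawing\<close>

abbreviation extremal_value :: "nat \<Rightarrow> nat \<Rightarrow> int" where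
  "extremal_value n d \<equiv> int n * int d * (3 * int n * int d - 2 * (int d)\<^sup>2 - 6 * int d + 2)"

text \<open>The perturbed drawing \<open>q\<close> keeps all proper crossings of \<open>p\<close>,
  so the abstract count for \<open>q\<close> bounds the quadruples of \<open>p\<close>. The factor
  24 is 3 times the 8 quadruples per crossing point.\<close>

lemma crossings_upper_bound:
  assumes R: "(V, E) \<in> regular_graphs n d" and p: "rectilinear_drawing V p"
  shows "24 * int (card (crossings V E p)) \<le> extremal_value n d"
proof -
  have G: "simple_graph V E" and n: "card V = n" and V: "\<And>e. e \<in> E \<Longrightarrow> e \<subseteq> V" and fin: "finite V"
    using R by (auto simp: regular_graphs_def simple_graph_def)
  obtain q :: "nat \<Rightarrow> real^2" where
    gp: "\<And>a b c. \<lbrakk>a \<in> V; b \<in> V; c \<in> V; distinct [a, b, c]\<rbrakk> \<Longrightarrow> orient (q a) (q b) (q c) \<noteq> 0"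
    and pq: "\<And>a b c e. \<lbrakk>{a, b, c, e} \<subseteq> V; proper_crossing (p a) (p b) (p c) (p e)\<rbrakk> \<Longrightarrow>
      proper_crossing (q a) (q b) (q c) (q e)"
    using general_position_perturbation[OF fin] by metis
  interpret ccw_regular_graph V "\<lambda>a b. {a, b} \<in> E" "\<lambda>a b c. 0 < orient (q a) (q b) (q c)" d
    by (rule ccw_regular_graph_of_drawing[OF R gp])
  have "crossing_quads E p \<subseteq> {(a, b, c, e) \<in> disjoint_pairs. cross a b c e}"
  proof
    fix z assume z: "z \<in> crossing_quads E p"
    then obtain a b c e where abce: "z = (a, b, c, e)" and E: "{a, b} \<in> E" "{c, e} \<in> E"
      and pc: "proper_crossing (p a) (p b) (p c) (p e)"
      by (auto simp: crossing_quads_def)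
    have "proper_crossing (q a) (q b) (q c) (q e)"
      using pq[OF _ pc] V E by blast
    then have "cross a b c e"
      unfolding cross_def proper_crossing_def by (auto simp: mult_less_0_iff)
    moreover have "distinct [a, b, c, e]" using proper_crossing_distinct[OF pc] by auto
    ultimately show "z \<in> {(a, b, c, e) \<in> disjoint_pairs. cross a b c e}"
      using E unfolding abce disjoint_pairs_def by simp
  qed
  then have "card (crossing_quads E p) \<le> card {(a, b, c, e) \<in> disjoint_pairs. cross a b c e}"
    by (intro card_mono finite_subset[OF _ finite_disjoint_pairs]) auto
  moreover have "8 * card (crossings V E p) \<le> card (crossing_quads E p)"
    using p by (intro eight_crossings_le[OF G]) (simp add: rectilinear_drawing_def)
  ultimately show ?thesis using crossing_pairs_le unfolding n by linarith
qed

section \<open>The circulant extremal graph\<close>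

text \<open>The extremal graph joins \<open>i\<close> and \<open>j\<close> when their cyclic distance modulo \<open>n\<close> is at least
  \<open>s\<close>; the degree is then \<open>n + 1 - 2 * s\<close>, which explains the parity condition.\<close>

definition far :: "nat \<Rightarrow> nat \<Rightarrow> nat \<Rightarrow> nat \<Rightarrow> bool" where
  "far n s i j \<longleftrightarrow> i < n \<and> j < n \<and> (i + s \<le> j \<and> j + s \<le> i + n \<or> j + s \<le> i \<and> i + s \<le> j + n)"

definition far_edges :: "nat \<Rightarrow> nat \<Rightarrow> nat set set" where
  "far_edges n s = {{i, j} |i j. far n s i j}"

lemma far_commute: "far n s i j \<longleftrightarrow> far n s j i"
  by (auto simp: far_def)

lemma far_edges_iff [simp]: "{i, j} \<in> far_edges n s \<longleftrightarrow> far n s i j"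
  using far_commute by (auto simp: far_edges_def doubleton_eq_iff)

text \<open>The neighbours of \<open>i\<close> are its translates modulo \<open>n\<close> by the
  elements of \<open>{s..n - s}\<close>.\<close>

lemma card_far:
  assumes "i < n" "0 < s" "2 * s \<le> n + 1"
  shows "card {j. far n s i j} = n + 1 - 2 * s"
proof -
  have "bij_betw (\<lambda>k. if i + k < n then i + k else i + k - n) {s..n - s} {j. far n s i j}"
  proof (rule bij_betw_byWitness[where f' = "\<lambda>j. if i \<le> j then j - i else j + n - i"])
    show "\<forall>k\<in>{s..n - s}. (\<lambda>j. if i \<le> j then j - i else j + n - i) (if i + k < n then i + k else i + k - n) = k"
      using assms by auto
    show "\<forall>j\<in>{j. far n s i j}. (\<lambda>k. if i + k < n then i + k else i + k - n) (if i \<le> j then j - i else j + n - i) = j"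
      using assms by (auto simp: far_def)
    show "(\<lambda>k. if i + k < n then i + k else i + k - n) ` {s..n - s} \<subseteq> {j. far n s i j}"
      using assms by (auto simp: far_def)
    show "(\<lambda>j. if i \<le> j then j - i else j + n - i) ` {j. far n s i j} \<subseteq> {s..n - s}"
      using assms by (auto simp: far_def)
  qed
  then have "card {j. far n s i j} = card {s..n - s}" by (rule bij_betw_same_card[symmetric])
  then show ?thesis using assms by simp
qed

lemma far_regular:
  assumes "0 < s" "2 * s + d = n + 1"
  shows "({..<n}, far_edges n s) \<in> regular_graphs n d"
proof -
  have G: "simple_graph {..<n} (far_edges n s)"
    using assms(1) by (auto simp: simple_graph_def far_edges_def far_def)
  moreover have "degree (far_edges n s) v = d" if "v < n" for v
    using card_incident_edges[OF G, of v] card_far[OF that assms(1)] assms(2) by simp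
  ultimately show ?thesis by (simp add: regular_graphs_def)
qed

text \<open>The reflection of the cyclic order on \<open>{..<n}\<close> that exchanges \<open>a\<close> and \<open>c\<close>.\<close>

definition reflect :: "nat \<Rightarrow> nat \<Rightarrow> nat \<Rightarrow> nat \<Rightarrow> nat" where
  "reflect n a c w =
    (if a + c < w then a + c + n - w else if a + c - w < n then a + c - w else a + c - w - n)"

lemma reflect_simps:
  assumes "a < n" "c < n" "w < n"
  shows "reflect n a c (reflect n a c w) = w" "reflect n a c a = c" "reflect n a c c = a"
  using assms by (auto simp: reflect_def)

text \<open>The image of \<open>w\<close> is \<open>a + c - w\<close> modulo \<open>n\<close>.
  Writing the congruence as three linear equations leaves later claims to linear arithmetic.\<close>

lemma reflect_cases:
  assumes "a < n" "c < n" "w < n"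
  shows "reflect n a c w < n \<and> (reflect n a c w + w = a + c \<or> reflect n a c w + w = a + c + n \<or> reflect n a c w + w + n = a + c)"
  using assms by (auto simp: reflect_def)

lemma far_reflect:
  assumes "a < n" "c < n" "far n s v w"
  shows "far n s (reflect n a c v) (reflect n a c w)"
proof -
  have "far n s x y" if "x < n \<and> (x + v = t \<or> x + v = t + n \<or> x + v + n = t)"
   "y < n \<and> (y + w = t \<or> y + w = t + n \<or> y + w + n = t)" for x y t
    using that assms(3) unfolding far_def by (elim conjE disjE) simp_all
  then show ?thesis using reflect_cases[OF assms(1,2)] assms(3) unfolding far_def by blast
qed

lemma cyclic_reflect:
  assumes "a < n" "c < n" "u < n" "v < n" "w < n"
  shows "cyclic (reflect n a c u) (reflect n a c v) (reflect n a c w) \<longleftrightarrow> cyclic w v u"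
proof -
  have "cyclic x y z \<longleftrightarrow> cyclic w v u" if "x < n \<and> (x + u = t \<or> x + u = t + n \<or> x + u + n = t)"
   "y < n \<and> (y + v = t \<or> y + v = t + n \<or> y + v + n = t)"
   "z < n \<and> (z + w = t \<or> z + w = t + n \<or> z + w + n = t)" for x y z t
    using that assms(3-5) unfolding cyclic_def by (elim conjE disjE) linarith+
  then show ?thesis using reflect_cases[OF assms(1,2)] assms(3-5) by blast
qed

text \<open>The points \<open>b\<close> and \<open>e\<close> lie on different arcs between
  \<open>a\<close> and \<open>c\<close>. One arc contains the far pair \<open>a b\<close> and the
  other the far pair \<open>c e\<close>, so both have length at least \<open>s\<close>.\<close>

lemma far_separated:
  assumes "far n s a b" "far n s c e" "distinct [a, b, c, e]" "cyclic a c b \<noteq> cyclic a c e"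
  shows "far n s a c"
proof (cases "a < c")
  case True
  then have "(a < b \<and> b < c) \<noteq> (a < e \<and> e < c)"
    using assms(3,4) unfolding cyclic_def by auto
  then show ?thesis
    using True assms(1-3) unfolding far_def by simp linarith
next
  case False
  then have "(c < b \<and> b < a) \<noteq> (c < e \<and> e < a)"
    using assms(3,4) unfolding cyclic_def by auto
  then show ?thesis
    using False assms(1-3) unfolding far_def by simp linarith
qed

lemma far_crossings:
  assumes s: "0 < s" "2 * s + d = n + 1" and "0 < d"
  shows "extremal_value n d \<le> 24 * int (card (crossings {..<n} (far_edges n s) parabola))"
proof -
  let ?E = "far_edges n s"
  have R: "({..<n}, ?E) \<in> regular_graphs n d" by (rule far_regular[OF s])
  then have G: "simple_graph {..<n} ?E" by (simp add: regular_graphs_def)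
  interpret ccw_regular_graph "{..<n}" "far n s" cyclic d
    using ccw_regular_graph_of_drawing[OF R orient_parabola_nonzero]
    by (simp add: orient_parabola_pos_iff)
  have rotate: "cyclic u v w = cyclic v w u" for u v w using ccw_rotate by blast
  \<comment> \<open>The reflection exchanges \<open>a\<close> and \<open>c\<close>, preserves
    adjacency and reverses the cyclic order. It thus maps neighbours of \<open>a\<close> to
    neighbours of \<open>c\<close> on the same side of \<open>a c\<close>, which gives
    \<open>balanced\<close>.\<close>
  have reflect_left_right: "reflect n a c ` left a c \<subseteq> right c a \<and> reflect n a c ` right c a \<subseteq> left a c"
    if "far n s a c" for a c
  proof -
    have ac: "a < n" "c < n" "a \<noteq> c" using that s(1) by (auto simp: far_def)
    have fix_ac: "reflect n a c a = c" "reflect n a c c = a"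
      using reflect_simps[OF ac(1,2)] ac by blast+
    have "reflect n a c b \<in> right c a" if "b \<in> left a c" for b
    proof -
      have b: "far n s a b" "b \<noteq> c" "b \<noteq> a" "b < n" "cyclic a c b"
        using that s(1) by (auto simp: left_def far_def)
      have swap: "cyclic c a b \<longleftrightarrow> \<not> cyclic a c b"
        using ccw_swap[of a c b] ac b by simp
      have "far n s c (reflect n a c b)"
        using far_reflect[OF ac(1,2) b(1)] unfolding fix_ac .
      moreover have "reflect n a c b \<noteq> a"
        using reflect_simps(1)[OF ac(1,2) b(4)] fix_ac b(2) by auto
      moreover have "\<not> cyclic c a (reflect n a c b)"
        using cyclic_reflect[OF ac(1,2) ac(1,2) b(4)] rotate[of b c a] swap b(5) unfolding fix_ac by simp
      ultimately show ?thesis by (simp add: right_def)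
    qed
    moreover have "reflect n a c b \<in> left a c" if "b \<in> right c a" for b
    proof -
      have b: "far n s c b" "b \<noteq> c" "b \<noteq> a" "b < n" "\<not> cyclic c a b"
        using that s(1) by (auto simp: right_def far_def)
      have swap: "cyclic a c b \<longleftrightarrow> \<not> cyclic c a b"
        using ccw_swap[of c a b] ac b by simp
      have "far n s a (reflect n a c b)"
        using far_reflect[OF ac(1,2) b(1)] unfolding fix_ac .
      moreover have "reflect n a c b \<noteq> c"
        using reflect_simps(1)[OF ac(1,2) b(4)] fix_ac b(3) by auto
      moreover have "cyclic a c (reflect n a c b)"
        using cyclic_reflect[OF ac(1,2) ac(2,1) b(4)] rotate[of b a c] swap b(5) unfolding fix_ac by simp
      ultimately show ?thesis by (simp add: left_def)
    qed
    ultimately show ?thesis by blast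
  qed
  have "3 * int (card {(a, b, c, e) \<in> disjoint_pairs. cross a b c e}) = extremal_value (card {..<n}) d"
  proof (rule crossing_pairs_eq)
    show "card (left a c) = card (right c a)" if "far n s a c" for a c
    proof (rule bij_betw_same_card[of "reflect n a c"], rule bij_betw_byWitness[where f' = "reflect n a c"])
      show "\<forall>b\<in>left a c. reflect n a c (reflect n a c b) = b" "\<forall>b\<in>right c a. reflect n a c (reflect n a c b) = b"
        using that reflect_simps(1) by (auto simp: left_def right_def far_def)
    qed (use reflect_left_right[OF that] in auto)
    show "far n s a c"
      if "far n s a b" "far n s c e" "distinct [a, b, c, e]" "separated a c b e" for a b c e
      using far_separated[OF that(1-3)] that(4) unfolding separated_def by blast
    show "\<not> (cyclic v x y = cyclic v y z \<and> cyclic v y z = cyclic v z x)"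
      if "distinct [v, x, y, z]" for v x y z
      by (rule cyclic_not_surrounded[OF that])
  qed (rule \<open>0 < d\<close>)
  moreover have "{(a, b, c, e) \<in> disjoint_pairs. cross a b c e} \<subseteq> crossing_quads ?E parabola"
  proof
    fix z assume "z \<in> {(a, b, c, e) \<in> disjoint_pairs. cross a b c e}"
    then obtain a b c e where z: "z = (a, b, c, e)" and E: "far n s a b" "far n s c e"
      and dist: "distinct [a, b, c, e]" and "cross a b c e"
      by (auto simp: disjoint_pairs_def)
    have opposite: "x * y < 0" if "x \<noteq> 0" "y \<noteq> 0" "(0 < x) \<noteq> (0 < y)" for x y :: real
      using that by (auto simp: mult_less_0_iff)
    have "proper_crossing (parabola a) (parabola b) (parabola c) (parabola e)"
      unfolding proper_crossing_def
      using \<open>cross a b c e\<close> dist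
      by (intro conjI opposite orient_parabola_nonzero) (auto simp: cross_def orient_parabola_pos_iff)
    then show "z \<in> crossing_quads ?E parabola"
      using E by (simp add: z crossing_quads_def)
  qed
  then have "card {(a, b, c, e) \<in> disjoint_pairs. cross a b c e} \<le> card (crossing_quads ?E parabola)"
    by (intro card_mono finite_crossing_quads[OF G])
  moreover have "card (crossing_quads ?E parabola) \<le> 8 * card (crossings {..<n} ?E parabola)"
    by (rule crossing_quads_le[OF G parabola_crossing[OF G]])
  ultimately show ?thesis unfolding card_lessThan by linarith
qed

theorem theorem3p1:
  fixes n d :: nat
  assumes "2 \<le> d" and "d \<le> n - 1" and "(n + d) mod 2 = 1"
  shows "real (max_rect_cr_regular n d) =
    1 / 24 * real n * real d * (3 * real n * real d - 2 * (real d)\<^sup>2 - 6 * real d + 2)"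
proof -
  \<comment> \<open>The parity of \<open>n + d\<close> makes the division exact, and
    \<open>d \<le> n - 1\<close> makes \<open>s\<close> positive, so that no vertex is far from
    itself.\<close>
  define s where "s = (n + 1 - d) div 2"
  have s: "0 < s" "2 * s + d = n + 1" using assms unfolding s_def by presburger+
  have le: "24 * int (max_rect_cr V E) \<le> extremal_value n d" if R: "(V, E) \<in> regular_graphs n d" for V E
  proof -
    have G: "simple_graph V E" using R by (simp add: regular_graphs_def)
    have "max_rect_cr V E \<in> {card (crossings V E p) |p. rectilinear_drawing V p}"
      unfolding max_rect_cr_def
      by (rule Max_in[OF max_rect_cr_set_finite[OF G] max_rect_cr_set_nonempty[OF G]])
    then show ?thesis using crossings_upper_bound[OF R] by auto
  qed
  have R: "({..<n}, far_edges n s) \<in> regular_graphs n d" by (rule far_regular[OF s])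
  then have G: "simple_graph {..<n} (far_edges n s)" by (simp add: regular_graphs_def)
  let ?S = "{max_rect_cr V E |V E. (V, E) \<in> regular_graphs n d}"
  \<comment> \<open>The circulant graph shows that the class is nonempty, so the maximum is
    attained.\<close>
  have "max_rect_cr_regular n d \<in> ?S"
    unfolding max_rect_cr_regular_def
    using R by (intro Max_in max_rect_cr_regular_set_finite) blast
  then have "24 * int (max_rect_cr_regular n d) \<le> extremal_value n d" using le by auto
  moreover have "extremal_value n d \<le> 24 * int (max_rect_cr_regular n d)"
  proof -
    have "rectilinear_drawing {..<n} parabola"
      by (auto simp: rectilinear_drawing_def inj_on_def)
    then have "card (crossings {..<n} (far_edges n s) parabola) \<le> max_rect_cr {..<n} (far_edges n s)"
      unfolding max_rect_cr_def by (intro Max_ge max_rect_cr_set_finite[OF G]) auto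
    also have "\<dots> \<le> max_rect_cr_regular n d"
      unfolding max_rect_cr_regular_def
      using R by (intro Max_ge max_rect_cr_regular_set_finite) blast
    finally show ?thesis using far_crossings[OF s] assms(1) by linarith
  qed
  ultimately have "24 * int (max_rect_cr_regular n d) = extremal_value n d" by (rule antisym)
  then have "real_of_int (24 * int (max_rect_cr_regular n d)) = real_of_int (extremal_value n d)"
    by (rule arg_cong)
  then show ?thesis by (simp add: algebra_simps)
qed

end
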